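(* Under the standing assumptions, let $u\in C^2(\mathbb R^d)$ with $u>0$ and $\mathfrak L^\sharp u\le-\frac{\lambda_c}{2}u$ on $\mathbb R^d$. Then for every compact $A\subset\mathbb R^d$, $$\limsup_{t\to\infty}\frac1t\ln\int_{X_t(A)}u(y)\,\mathrm{d}y\le-\frac{\lambda_c}{2}\quad\text{a.s.}$$
   Context: Standing assumptions: $d\ge 2$; $b$ is a standard $d$-dimensional Brownian motion; $\sigma$ is a constant $d\times d$ positive-definite matrix and $a:=\sigma\sigma^{T}$; the drift $m:\mathbb R^d\to\mathbb R^d$ belongs to $C^{1,1}(\mathbb R^d)$; there is a potential $\psi:\mathbb R^d\to(0,\infty)$ with $m=-a\nabla\ln\psi$ and $\int_{\mathbb R^d}\psi^{-2}\,\mathrm{d}x=1$; and there is a constant $\lambda_c>0$ with $(\nabla\cdot m)(x)\le-\lambda_c$ for all $x$. $X_t(x,b)$ is the stochastic flow of global diffeomorphisms solving $X_t=x+\sigma b(t)+\int_0^t m(X_s)\,\mathrm{d}s$, and $X_t(A)$ is the image of $A$ under it. The operator $\mathfrak L^\sharp$ acts on $f\in C^2$ by $\mathfrak L^\sharp f=\tfrac12\nabla\cdot(a\nabla f)+m\cdot\nabla f+(\nabla\cdot m)f$. *)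

theory Defs
  imports "HOL-Probability.Probability"
begin

definition grad :: "(real^'n \<Rightarrow> real) \<Rightarrow> real^'n \<Rightarrow> real^'n" where
  "grad f x = (\<chi> i. frechet_derivative f (at x) (axis i 1))"

definition divg :: "(real^'n \<Rightarrow> real^'n) \<Rightarrow> real^'n \<Rightarrow> real" where
  "divg F x = (\<Sum>i\<in>UNIV. frechet_derivative F (at x) (axis i 1) $ i)"

definition C2 :: "(real^'n \<Rightarrow> real) \<Rightarrow> bool" where
  "C2 u \<longleftrightarrow> (\<forall>x. u differentiable (at x)) \<and> (\<forall>x. grad u differentiable (at x)) \<and>
     (\<forall>i j. continuous_on UNIV (\<lambda>x. frechet_derivative (grad u) (at x) (axis j 1) $ i))"

definition C11 :: "(real^'n \<Rightarrow> real^'n) \<Rightarrow> bool" where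
  "C11 m \<longleftrightarrow> (\<forall>x. m differentiable (at x)) \<and>
     (\<exists>L. \<forall>x y h. norm (frechet_derivative m (at x) h - frechet_derivative m (at y) h)
                      \<le> L * dist x y * norm h)"

definition Lsharp :: "real^'n^'n \<Rightarrow> (real^'n \<Rightarrow> real^'n) \<Rightarrow> (real^'n \<Rightarrow> real) \<Rightarrow> real^'n \<Rightarrow> real" where
  "Lsharp a m f x = 1/2 * divg (\<lambda>y. a *v grad f y) x + m x \<bullet> grad f x + divg m x * f x"

definition std_brownian_motion :: "'w measure \<Rightarrow> (real \<Rightarrow> 'w \<Rightarrow> real^'n) \<Rightarrow> bool" where
  "std_brownian_motion M b \<longleftrightarrow> prob_space M \<and>
     (\<forall>t. b t \<in> borel_measurable M) \<and>
     (\<forall>\<omega>\<in>space M. b 0 \<omega> = 0 \<and> continuous_on {0..} (\<lambda>t. b t \<omega>)) \<and>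
     (\<forall>(t::nat \<Rightarrow> real) k. 0 \<le> t 0 \<and> (\<forall>i<k. t i < t (Suc i)) \<longrightarrow>
        prob_space.indep_vars M (\<lambda>_. borel) (\<lambda>(i, j) \<omega>. b (t (Suc i)) \<omega> $ j - b (t i) \<omega> $ j)
           ({..<k} \<times> UNIV) \<and>
        (\<forall>i<k. \<forall>j. distributed M lborel (\<lambda>\<omega>. b (t (Suc i)) \<omega> $ j - b (t i) \<omega> $ j)
                       (\<lambda>x. ennreal (normal_density 0 (sqrt (t (Suc i) - t i)) x))))"

text \<open>Natural logarithm extended to [0,\<infinity>) with ln 0 = -\<infinity> (the integral may vanish, e.g. for A a point).\<close>
definition eln :: "real \<Rightarrow> ereal" where
  "eln r = (if r \<le> 0 then - \<infinity> else ereal (ln r))"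

end

theory Submission
  imports Defs
begin

text \<open>
  The noise is additive, so for a fixed Brownian path the flow is the flow of an ordinary differential
  equation and can be approximated by the explicit Euler scheme driven by the increments of
  \<open>\<sigma> b\<close>. The Jacobian determinant of one Euler step of length \<open>h\<close> at \<open>y\<close> is
  \<open>1 + h (\<nabla> \<cdot> m)(y) + O(h\<^sup>2)\<close>, and together with a second order Taylor expansion of \<open>u\<close> and the moments
  of the Gaussian increment this shows that the expectation of \<open>u\<close> at the new point times the Jacobian
  is at most \<open>u(y) + h L\<^sup>\<sharp> u(y) + o(h) \<le> (1 - (\<lambda>/2 - \<epsilon>) h) u(y)\<close>, uniformly for \<open>y\<close> in a ball. Hence the
  integral of \<open>u\<close> over the Euler image of a ball, renormalised and killed on leaving a large ball, is
  dominated by a nonnegative supermartingale, and the maximal inequality bounds it uniformly in time with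
  high probability, uniformly in the step size.

  Neither differentiability of the exact flow nor Liouville's formula is needed: the time-\<open>t\<close> map is
  injective and continuous, so by invariance of domain and Brouwer's fixed point theorem the image of \<open>A\<close>
  is covered by the image of a slightly larger ball under every map that is uniformly close,
  in particular under the Euler maps of small step size.
\<close>

section \<open>Change of variables for arbitrary finite index types\<close>

text \<open>The thresholds on step size and killing radius beyond which the Euler scheme follows the
  flow depend on the path and on the time, while the maximal inequality concerns one scheme at a
  time. Hence a sequence of schemes is used, the n-th with step at most 1/(n+1), radius n and
  horizon n. For every n, the event that its discounted mass ever reaches c+1 has probability at
  most V/(c+1). These bounds are not summable in n, so Borel-Cantelli is of no avail; but the paths
  that for every c lie in all but finitely many of these events form a null set. Almost surely some
  c is therefore good for infinitely many n, and this one constant serves all times: for each t a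
  good n beyond the thresholds of that t is picked. The flow is given path by path, without
  measurability in the sample point, so probability enters only through functions of finitely many
  increments. Killing also has an analytic purpose: u may grow so fast that its Gaussian mean is
  infinite, and only on a ball is u bounded away from 0, which turns an additive error o(h) into a
  relative one. The price is an arbitrarily small loss in the rate, removed along a sequence of
  losses tending to 0.\<close>

text \<open>
  The change of variables theorems of HOL-Analysis are restricted to well-ordered index types. This copy of
  \<open>'n\<close> carries a well-order, and reindexing along it preserves determinants and Lebesgue measure.
\<close>
datatype 'n ord_index = Ord_Index (the_index: 'n)

instance ord_index :: (finite) finite
proof
  have "(UNIV :: 'a ord_index set) = range Ord_Index"
    by (metis UNIV_eq_I ord_index.exhaust rangeI)
  then show "finite (UNIV :: 'a ord_index set)"
    by (metis finite finite_imageI)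
qed

instantiation ord_index :: (finite) linorder
begin
definition less_eq_ord_index :: "'a ord_index \<Rightarrow> 'a ord_index \<Rightarrow> bool" where
  "i \<le> j \<longleftrightarrow> to_nat (the_index i) \<le> to_nat (the_index j)"
definition less_ord_index :: "'a ord_index \<Rightarrow> 'a ord_index \<Rightarrow> bool" where
  "i < j \<longleftrightarrow> to_nat (the_index i) < to_nat (the_index j)"
instance
  by standard (auto simp: less_eq_ord_index_def less_ord_index_def ord_index.expand)
end

instance ord_index :: (finite) wellorder
proof
  fix P :: "'a ord_index \<Rightarrow> bool" and a
  assume *: "\<And>x. (\<And>y. y < x \<Longrightarrow> P y) \<Longrightarrow> P x"
  show "P a"
    by (induction a rule: measure_induct_rule[where f = "\<lambda>i. to_nat (the_index i)"])
      (metis * less_ord_index_def)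
qed

text \<open>\<open>map_permutation UNIV e\<close> conjugates a permutation by \<open>e\<close>. This
  is a sign-preserving bijection between the two symmetric groups, so the Leibniz sums agree term by
  term.\<close>

lemma det_reindex:
  fixes A :: "real^'n^'n" and e :: "'k::finite \<Rightarrow> 'n::finite"
  assumes e: "bij e"
  shows "det (\<chi> i j. A $ e i $ e j) = det A"
proof -
  let ?f = "map_permutation UNIV e"
  have inj: "inj e" and surj: "surj e" using e by (auto simp: bij_def)
  have "det A = (\<Sum>p\<in>{p. p permutes UNIV}. of_int (sign p) * (\<Prod>i\<in>UNIV. A $ i $ p i))"
    by (simp add: det_def)
  also have "\<dots> = (\<Sum>p\<in>{p. p permutes (UNIV :: 'k set)}. of_int (sign (?f p)) * (\<Prod>i\<in>UNIV. A $ i $ ?f p i))"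
  proof (rule sum.reindex_bij_witness[where j = "map_permutation UNIV (inv e)" and i = ?f])
    fix p :: "'n \<Rightarrow> 'n" assume p: "p \<in> {p. p permutes UNIV}"
    show "?f (map_permutation UNIV (inv e) p) = p"
      by (rule map_permutation_compose_inv[where A = UNIV and B = UNIV])
        (use p e bij_imp_bij_inv[OF e] in \<open>auto simp: bij_def surj_f_inv_f\<close>)
    then show "of_int (sign (?f (map_permutation UNIV (inv e) p))) *
        (\<Prod>i\<in>UNIV. A $ i $ ?f (map_permutation UNIV (inv e) p) i) = of_int (sign p) * (\<Prod>i\<in>UNIV. A $ i $ p i)"
      by simp
    show "map_permutation UNIV (inv e) p \<in> {p. p permutes UNIV}"
      using p map_permutation_permutes[of "inv e" UNIV UNIV p] bij_imp_bij_inv[OF e] by simp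
  next
    fix p :: "'k \<Rightarrow> 'k" assume p: "p \<in> {p. p permutes UNIV}"
    show "map_permutation UNIV (inv e) (?f p) = p"
      by (rule map_permutation_compose_inv[where A = UNIV and B = UNIV])
        (use p e inj in \<open>auto simp: bij_def\<close>)
    show "?f p \<in> {p. p permutes UNIV}"
      using p map_permutation_permutes[of e UNIV UNIV p] e by simp
  qed
  also have "\<dots> = (\<Sum>p\<in>{p. p permutes (UNIV :: 'k set)}. of_int (sign p) * (\<Prod>i\<in>UNIV. A $ e i $ e (p i)))"
  proof (rule sum.cong, simp)
    fix p :: "'k \<Rightarrow> 'k" assume p: "p \<in> {p. p permutes UNIV}"
    have "(\<Prod>i\<in>UNIV. A $ i $ ?f p i) = (\<Prod>i\<in>UNIV. A $ e i $ ?f p (e i))"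
      by (rule prod.reindex_bij_betw[OF e, symmetric])
    also have "\<dots> = (\<Prod>i\<in>UNIV. A $ e i $ e (p i))"
      by (simp add: map_permutation_apply[OF inj])
    finally show "of_int (sign (?f p)) * (\<Prod>i\<in>UNIV. A $ i $ ?f p i) = 
        of_int (sign p) * (\<Prod>i\<in>UNIV. A $ e i $ e (p i))"
      using sign_map_permutation[OF inj] p by simp
  qed
  also have "\<dots> = det (\<chi> i j. A $ e i $ e j)"
    by (simp add: det_def)
  finally show ?thesis ..
qed

lemma prod_Basis_cart:
  fixes f :: "real^'n \<Rightarrow> 'b::comm_monoid_mult"
  shows "(\<Prod>b\<in>Basis. f b) = (\<Prod>i\<in>UNIV. f (axis i 1))"
proof -
  have *: "(Basis :: (real^'n) set) = range (\<lambda>i. axis i 1)"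
    by (auto simp: Basis_vec_def)
  have "inj (\<lambda>i::'n. axis i (1::real))"
    by (simp add: inj_on_def axis_eq_axis)
  then show ?thesis
    unfolding * by (simp add: prod.reindex)
qed

text \<open>Relabelling coordinates turns boxes into boxes and only permutes the factors of their
  volume, and Lebesgue measure is determined by its values on boxes.\<close>

lemma lborel_distr_reindex:
  fixes e :: "'k::finite \<Rightarrow> 'n::finite"
  assumes e: "bij e"
  shows "distr lborel borel (\<lambda>x::real^'n. (\<chi> i. x $ e i) :: real^'k) = lborel"
proof (rule lborel_eqI[symmetric])
  let ?T = "\<lambda>x::real^'n. (\<chi> i. x $ e i) :: real^'k"
  have lin: "linear ?T"
    by (auto intro!: linearI simp: vec_eq_iff)
  then have [measurable]: "?T \<in> borel_measurable borel"
    by (intro borel_measurable_continuous_onI linear_continuous_on linear_conv_bounded_linear[THEN iffD1])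
  have surj: "surj e" and inj: "inj e" using e by (auto simp: bij_def)
  fix l u :: "real^'k" assume lu: "\<And>b. b \<in> Basis \<Longrightarrow> l \<bullet> b \<le> u \<bullet> b"
  let ?S = "\<lambda>y::real^'k. (\<chi> i. y $ inv e i) :: real^'n"
  have lu': "?S l \<bullet> b \<le> ?S u \<bullet> b" if b: "b \<in> Basis" for b
  proof -
    obtain i where i: "b = axis i 1" using b by (auto simp: Basis_vec_def)
    have "axis (inv e i) (1::real) \<in> Basis" by (auto simp: Basis_vec_def)
    from lu[OF this] show ?thesis by (simp add: i inner_axis)
  qed
  have "?T -` box l u = box (?S l) (?S u)"
  proof (intro set_eqI)
    fix x
    have "(\<forall>i. l $ i < x $ e i \<and> x $ e i < u $ i) \<longleftrightarrow> (\<forall>i. l $ inv e i < x $ i \<and> x $ i < u $ inv e i)"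
      by (metis inj inv_f_f surj surj_f_inv_f)
    then show "x \<in> ?T -` box l u \<longleftrightarrow> x \<in> box (?S l) (?S u)"
      by (simp add: mem_box_cart)
  qed
  then have "emeasure (distr lborel borel ?T) (box l u) = emeasure lborel (box (?S l) (?S u))"
    by (subst emeasure_distr) auto
  also have "\<dots> = (\<Prod>b\<in>Basis. (?S u - ?S l) \<bullet> b)"
    by (rule emeasure_lborel_box[OF lu'])
  also have "(\<Prod>b\<in>Basis. (?S u - ?S l) \<bullet> b) = (\<Prod>i\<in>UNIV. (u - l) $ inv e i)"
    by (simp add: prod_Basis_cart inner_axis)
  also have "\<dots> = (\<Prod>i\<in>UNIV. (u - l) $ i)"
    by (rule prod.reindex_bij_betw[OF bij_imp_bij_inv[OF e]])
  finally show "emeasure (distr lborel borel ?T) (box l u) = (\<Prod>b\<in>Basis. (u - l) \<bullet> b)"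
    by (simp add: prod_Basis_cart inner_axis)
qed simp

text \<open>Only an inequality, because \<open>g\<close> need not be injective: overlaps are counted
  with multiplicity on the right. Compactness of \<open>S\<close> makes the integrals finite, so
  that the Henstock-Kurzweil estimate can be read as one between nonnegative integrals.\<close>

lemma nn_integral_image_le_wellorder:
  fixes g :: "real^'k::{finite,wellorder} \<Rightarrow> real^'k::_"
  assumes S: "compact S"
    and g: "\<And>x. (g has_derivative g' x) (at x)"
    and u: "continuous_on UNIV u" "\<And>x. 0 \<le> u x"
    and det: "continuous_on UNIV (\<lambda>x. det (matrix (g' x)))"
  shows "(\<integral>\<^sup>+x\<in>g ` S. ennreal (u x) \<partial>lborel) \<le> (\<integral>\<^sup>+x\<in>S. ennreal (\<bar>det (matrix (g' x))\<bar> * u (g x)) \<partial>lborel)"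
proof -
  have contg: "continuous_on UNIV g"
    using g by (meson continuous_at_imp_continuous_on has_derivative_continuous)
  let ?F = "\<lambda>x. \<bar>det (matrix (g' x))\<bar> * u (g x)"
  have "continuous_on S ?F"
    by (intro continuous_intros continuous_on_subset[OF det] continuous_on_compose2[OF u(1)]
        continuous_on_subset[OF contg]) auto
  then have "integrable lborel (\<lambda>x. indicator S x *\<^sub>R ?F x)"
    using S by (rule borel_integrable_compact[rotated])
  then have "set_integrable lborel S ?F"
    by (simp add: set_integrable_def)
  then have F: "?F integrable_on S"
    using set_borel_integral_eq_integral(1) by blast
  have *: "u integrable_on (g ` S) \<and> integral (g ` S) u \<le> integral S ?F"
    by (rule integral_on_image_ubound_nonneg)
      (use u(2) F g in \<open>auto intro: has_derivative_at_withinI\<close>)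
  have "(\<integral>\<^sup>+x\<in>g ` S. ennreal (u x) \<partial>lborel) = ennreal (integral (g ` S) u)"
    using * u(2) by (intro nn_integral_has_integral_lebesgue') (auto simp: has_integral_integral)
  also have "\<dots> \<le> ennreal (integral S ?F)"
    using * by (intro ennreal_leI) auto
  also have "\<dots> = (\<integral>\<^sup>+x\<in>S. ennreal (?F x) \<partial>lborel)"
    using F u(2) by (intro nn_integral_has_integral_lebesgue'[symmetric]) (auto simp: has_integral_integral)
  finally show ?thesis .
qed

text \<open>The map is conjugated by the relabelling \<open>T\<close>, which preserves Lebesgue
  measure; the Jacobian matrix of the conjugate has its rows and columns relabelled alike, hence the
  same determinant.\<close>

lemma nn_integral_image_le:
  fixes g :: "real^'n::finite \<Rightarrow> real^'n"
  assumes S: "compact S"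
    and g: "\<And>x. (g has_derivative g' x) (at x)"
    and u: "continuous_on UNIV u" "\<And>x. 0 \<le> u x"
    and det: "continuous_on UNIV (\<lambda>x. det (matrix (g' x)))"
  shows "(\<integral>\<^sup>+x\<in>g ` S. ennreal (u x) \<partial>lborel) \<le> (\<integral>\<^sup>+x\<in>S. ennreal (\<bar>det (matrix (g' x))\<bar> * u (g x)) \<partial>lborel)"
proof -
  define T :: "real^'n \<Rightarrow> real^('n ord_index)" where "T x = (\<chi> i. x $ the_index i)" for x
  define T' :: "real^('n ord_index) \<Rightarrow> real^'n" where "T' y = (\<chi> i. y $ Ord_Index i)" for y
  have bij: "bij (the_index :: 'n ord_index \<Rightarrow> 'n)"
    by (metis bijI' ord_index.expand ord_index.sel)
  have T'T: "T' (T x) = x" and TT': "T (T' y) = y" for x y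
    by (simp_all add: T_def T'_def vec_eq_iff)
  have lin: "bounded_linear T" "bounded_linear T'"
    by (auto intro!: linear_conv_bounded_linear[THEN iffD1] linearI simp: T_def T'_def vec_eq_iff)
  have cont: "continuous_on A T" "continuous_on B T'" for A B
    using lin by (auto intro: linear_continuous_on)
  have [measurable]: "T \<in> borel_measurable borel" "T' \<in> borel_measurable borel"
    using cont by (auto intro: borel_measurable_continuous_onI)
  have distr: "distr lborel borel T = lborel"
    using lborel_distr_reindex[OF bij] by (simp add: T_def[abs_def])
  let ?g = "\<lambda>y. T (g (T' y))" and ?g' = "\<lambda>y v. T (g' (T' y) (T' v))"
  have contg: "continuous_on UNIV g"
    using g by (meson continuous_at_imp_continuous_on has_derivative_continuous)
  have det_eq: "det (matrix (?g' y)) = det (matrix (g' (T' y)))" for y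
  proof -
    have "T' (axis j 1) = axis (the_index j) 1" for j
      by (auto simp: T'_def vec_eq_iff axis_def ord_index.expand)
    then have "matrix (?g' y) = (\<chi> i j. matrix (g' (T' y)) $ the_index i $ the_index j)"
      by (simp add: matrix_def T_def)
    then show ?thesis
      using det_reindex[OF bij] by simp
  qed
  have main: "(\<integral>\<^sup>+y\<in>?g ` (T ` S). ennreal (u (T' y)) \<partial>lborel)
      \<le> (\<integral>\<^sup>+y\<in>T ` S. ennreal (\<bar>det (matrix (?g' y))\<bar> * u (T' (?g y))) \<partial>lborel)"
  proof (rule nn_integral_image_le_wellorder)
    show "compact (T ` S)" using S cont by (intro compact_continuous_image) auto
    show "(?g has_derivative ?g' y) (at y)" for y
    proof -
      have "((g \<circ> T') has_derivative (g' (T' y) \<circ> T')) (at y)"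
        using g bounded_linear_imp_has_derivative[OF lin(2)] by (intro diff_chain_at)
      from diff_chain_at[OF this bounded_linear_imp_has_derivative[OF lin(1)]]
      show ?thesis by (simp add: o_def)
    qed
    show "continuous_on UNIV (\<lambda>y. u (T' y))"
      by (rule continuous_on_compose2[OF u(1) cont(2)]) simp
    show "continuous_on UNIV (\<lambda>y. det (matrix (?g' y)))"
      unfolding det_eq by (rule continuous_on_compose2[OF det cont(2)]) simp
  qed (use u in auto)
  have gS: "compact (g ` S)" 
    using S contg by (meson compact_continuous_image continuous_on_subset subset_UNIV)
  have [measurable]: "S \<in> sets borel" "g ` S \<in> sets borel" "u \<in> borel_measurable borel"
      "g \<in> borel_measurable borel" "(\<lambda>x. det (matrix (g' x))) \<in> borel_measurable borel"
      "T ` S \<in> sets borel" "T ` g ` S \<in> sets borel"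
    using S gS u contg det compact_continuous_image[OF cont(1) S] compact_continuous_image[OF cont(1) gS]
    by (auto intro: borel_measurable_continuous_onI borel_compact)
  have ind: "indicator (T ` A) (T x) = (indicator A x :: ennreal)" for A x
    by (metis (no_types, lifting) T'T image_iff indicator_simps)
  have "?g ` (T ` S) = T ` (g ` S)"
    by (auto simp: T'T image_iff)
  then have "(\<integral>\<^sup>+y\<in>?g ` (T ` S). ennreal (u (T' y)) \<partial>lborel) = (\<integral>\<^sup>+x\<in>g ` S. ennreal (u x) \<partial>lborel)"
    by (subst distr[symmetric]) (simp add: nn_integral_distr T'T ind)
  moreover have "(\<integral>\<^sup>+y\<in>T ` S. ennreal (\<bar>det (matrix (?g' y))\<bar> * u (T' (?g y))) \<partial>lborel)
      = (\<integral>\<^sup>+x\<in>S. ennreal (\<bar>det (matrix (g' x))\<bar> * u (g x)) \<partial>lborel)"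
    unfolding det_eq T'T
    by (subst distr[symmetric]) (simp add: nn_integral_distr T'T ind)
  ultimately show ?thesis using main by simp
qed

section \<open>Pathwise analysis of the flow\<close>

text \<open>A two-sided Gronwall estimate through the squared norm, which is differentiable even
  where \<open>D\<close> vanishes: weighted by \<open>exp (- 2 * L * s)\<close> it decreases,
  weighted by \<open>exp (2 * L * s)\<close> it increases. The first bound will give continuity of
  the flow in its starting point, the second injectivity.\<close>

lemma norm_growth_bounds:
  fixes D :: "real \<Rightarrow> 'a::euclidean_space"
  assumes T: "0 \<le> T" and L: "0 \<le> L"
    and D: "\<And>s. s \<in> {0..T} \<Longrightarrow> (D has_vector_derivative D' s) (at s within {0..T})"
    and le: "\<And>s. s \<in> {0..T} \<Longrightarrow> norm (D' s) \<le> L * norm (D s)"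
  shows "norm (D T) \<le> exp (L * T) * norm (D 0)" "norm (D 0) \<le> exp (L * T) * norm (D T)"
proof -
  have sq: "((\<lambda>s. D s \<bullet> D s) has_real_derivative 2 * (D s \<bullet> D' s)) (at s within {0..T})" if "s \<in> {0..T}" for s
  proof -
    have "((\<lambda>s. D s \<bullet> D s) has_vector_derivative (D s \<bullet> D' s + D' s \<bullet> D s)) (at s within {0..T})"
      using bounded_bilinear.has_vector_derivative[OF bounded_bilinear_inner D[OF that] D[OF that]] .
    then show ?thesis
      by (simp add: has_real_derivative_iff_has_vector_derivative inner_commute)
  qed
  have bd: "\<bar>D s \<bullet> D' s\<bar> \<le> L * (D s \<bullet> D s)" if "s \<in> {0..T}" for s
  proof -
    have "\<bar>D s \<bullet> D' s\<bar> \<le> norm (D s) * norm (D' s)"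
      by (rule Cauchy_Schwarz_ineq2)
    also have "\<dots> \<le> norm (D s) * (L * norm (D s))"
      using le[OF that] by (intro mult_left_mono) auto
    finally show ?thesis
      by (simp add: power2_norm_eq_inner[symmetric] power2_eq_square ac_simps)
  qed
  have E: "((\<lambda>s. exp (c * s) * (D s \<bullet> D s)) has_real_derivative
      exp (c * s) * (c * (D s \<bullet> D s) + 2 * (D s \<bullet> D' s))) (at s within {0..T})" if "s \<in> {0..T}" for c s
    by (rule derivative_eq_intros sq[OF that] refl | simp)+ (simp add: algebra_simps)
  have contD: "continuous_on {0..T} D"
    using D by (meson continuous_on_eq_continuous_within has_vector_derivative_continuous)
  have up: "exp (- 2 * L * T) * (D T \<bullet> D T) \<le> exp (- 2 * L * 0) * (D 0 \<bullet> D 0)"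
  proof -
    have "- (exp (- 2 * L * 0) * (D 0 \<bullet> D 0)) \<le> - (exp (- 2 * L * T) * (D T \<bullet> D T))"
    proof (rule DERIV_nonneg_imp_increasing_open[OF T])
      fix s assume s: "0 < s" "s < T"
      then have "((\<lambda>s. - (exp (- 2 * L * s) * (D s \<bullet> D s))) has_real_derivative
        - (exp (- 2 * L * s) * (- 2 * L * (D s \<bullet> D s) + 2 * (D s \<bullet> D' s)))) (at s)"
        using DERIV_minus[OF E[of s "- 2 * L"]] at_within_interior[of s "{0..T}"] by simp
      moreover have "0 \<le> - (exp (- 2 * L * s) * (- 2 * L * (D s \<bullet> D s) + 2 * (D s \<bullet> D' s)))"
        using bd[of s] s by (simp add: mult_le_0_iff)
      ultimately show "\<exists>y. ((\<lambda>s. - (exp (- 2 * L * s) * (D s \<bullet> D s))) has_real_derivative y) (at s) \<and> 0 \<le> y"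
        by blast
    qed (auto intro!: continuous_intros contD)
    then show ?thesis by simp
  qed
  have down: "exp (2 * L * 0) * (D 0 \<bullet> D 0) \<le> exp (2 * L * T) * (D T \<bullet> D T)"
  proof (rule DERIV_nonneg_imp_increasing_open[OF T])
    fix s assume s: "0 < s" "s < T"
    then have "((\<lambda>s. exp (2 * L * s) * (D s \<bullet> D s)) has_real_derivative
        exp (2 * L * s) * (2 * L * (D s \<bullet> D s) + 2 * (D s \<bullet> D' s))) (at s)"
      using E[of s "2 * L"] at_within_interior[of s "{0..T}"] by simp
    moreover have "0 \<le> exp (2 * L * s) * (2 * L * (D s \<bullet> D s) + 2 * (D s \<bullet> D' s))"
      using bd[of s] s by simp
    ultimately show "\<exists>y. ((\<lambda>s. exp (2 * L * s) * (D s \<bullet> D s)) has_real_derivative y) (at s) \<and> 0 \<le> y"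
      by blast
  qed (auto intro!: continuous_intros contD)
  have sq_exp: "exp (2 * L * T) = (exp (L * T))\<^sup>2"
    by (simp add: exp_double[symmetric] ac_simps)
  have "(norm (D T))\<^sup>2 \<le> (exp (L * T) * norm (D 0))\<^sup>2"
    using up by (simp add: power_mult_distrib power2_norm_eq_inner sq_exp[symmetric] exp_minus field_simps)
  then show "norm (D T) \<le> exp (L * T) * norm (D 0)"
    by (rule power2_le_imp_le) simp
  have "(norm (D 0))\<^sup>2 \<le> (exp (L * T) * norm (D T))\<^sup>2"
    using down by (simp add: power_mult_distrib power2_norm_eq_inner sq_exp[symmetric])
  then show "norm (D 0) \<le> exp (L * T) * norm (D T)"
    by (rule power2_le_imp_le) simp
qed

lemma image_subset_image_uniformly_close:
  fixes F :: "'a::euclidean_space \<Rightarrow> 'a"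
  assumes F: "continuous_on UNIV F" "inj F" and U: "open U" and A: "compact A" "A \<subseteq> U"
  obtains \<eta> where "\<eta> > 0" "\<And>f. continuous_on U f \<Longrightarrow> (\<And>x. x \<in> U \<Longrightarrow> norm (f x - F x) \<le> \<eta>) \<Longrightarrow> F ` A \<subseteq> f ` U"
proof -
  have inj: "inj_on F U" and cont: "continuous_on S F" for S
    using F by (auto intro: inj_on_subset continuous_on_subset)
  have open_FU: "open (F ` U)"
    using cont U inj by (rule invariance_of_domain)
  obtain G where G: "homeomorphism U (F ` U) F G"
    using invariance_of_domain_homeomorphism[OF U cont _ inj] by blast
  obtain \<eta> where \<eta>: "\<eta> > 0" "(\<Union>y\<in>F ` A. cball y \<eta>) \<subseteq> F ` U"
    using compact_subset_open_imp_cball_epsilon_subset[OF compact_continuous_image[OF cont A(1)] open_FU]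
      image_mono[OF A(2)] by metis
  show thesis
  proof (rule that[OF \<eta>(1)])
    fix f assume f: "continuous_on U f" "\<And>x. x \<in> U \<Longrightarrow> norm (f x - F x) \<le> \<eta>"
    show "F ` A \<subseteq> f ` U"
    proof
      fix y assume y: "y \<in> F ` A"
      have GU: "G z \<in> U" "F (G z) = z" if "z \<in> cball y \<eta>" for z
        using \<eta>(2) y that G by (auto simp: homeomorphism_def subset_iff)
      obtain z where z: "z \<in> cball y \<eta>" "z - f (G z) + y = z"
      proof (rule brouwer_ball[OF \<eta>(1)])
        show "continuous_on (cball y \<eta>) (\<lambda>z. z - f (G z) + y)"
          by (intro continuous_intros continuous_on_compose2[OF f(1)] continuous_on_subset[OF homeomorphism_cont2[OF G]])
            (use GU \<eta>(2) y in auto)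
        show "(\<lambda>z. z - f (G z) + y) \<in> cball y \<eta> \<rightarrow> cball y \<eta>"
        proof
          fix z assume z: "z \<in> cball y \<eta>"
          have "dist y (z - f (G z) + y) = norm (f (G z) - F (G z))"
            using GU(2)[OF z] by (simp add: dist_norm)
          then show "z - f (G z) + y \<in> cball y \<eta>"
            using f(2) GU(1)[OF z] by simp
        qed
      qed
      then have "f (G z) = y" by simp
      then show "y \<in> f ` U" using GU(1)[OF z(1)] by blast
    qed
  qed
qed

section \<open>Flow and Euler scheme along one fixed noise path\<close>

text \<open>The increments \<open>w\<close> are a free argument, so that the same scheme accepts a
  fixed path in the pathwise estimates and the coordinates of a product space in the probabilistic
  ones.\<close>

primrec euler :: "('a::real_vector \<Rightarrow> 'a) \<Rightarrow> real \<Rightarrow> (nat \<Rightarrow> 'a) \<Rightarrow> nat \<Rightarrow> 'a \<Rightarrow> 'a" where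
  "euler m h w 0 x = x"
| "euler m h w (Suc k) x = euler m h w k x + h *\<^sub>R m (euler m h w k x) + w k"

text \<open>One sample point is frozen and \<open>\<beta>\<close> is its noise path. The Lipschitz
  constant is local because a drift with Lipschitz derivative may grow quadratically.\<close>

locale additive_noise_flow =
  fixes m :: "'a::euclidean_space \<Rightarrow> 'a" and \<beta> :: "real \<Rightarrow> 'a" and X :: "real \<Rightarrow> 'a \<Rightarrow> 'a"
  assumes m_lipschitz: "\<And>R. \<exists>L\<ge>0. \<forall>x\<in>cball 0 R. \<forall>y\<in>cball 0 R. norm (m x - m y) \<le> L * norm (x - y)"
    and m_cont: "continuous_on UNIV m"
    and noise_cont: "continuous_on {0..} \<beta>"
    and noise_0: "\<beta> 0 = 0"
    and flow_cont: "\<And>x. continuous_on {0..} (\<lambda>s. X s x)"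
    and flow_eq: "\<And>x t. 0 \<le> t \<Longrightarrow> X t x = x + \<beta> t + integral {0..t} (\<lambda>s. m (X s x))"
begin

lemma flow_0: "X 0 x = x"
  by (subst flow_eq) (auto simp: noise_0)

lemma drift_cont: "continuous_on {a..b} (\<lambda>s. m (X s x))" if "0 \<le> a"
  by (rule continuous_on_compose2[OF m_cont continuous_on_subset[OF flow_cont]]) (use that in auto)

lemma flow_diff_eq:
  assumes "0 \<le> s" "s \<le> t"
  shows "X t x - X s x = \<beta> t - \<beta> s + integral {s..t} (\<lambda>r. m (X r x))"
proof -
  have "integral {0..s} (\<lambda>r. m (X r x)) + integral {s..t} (\<lambda>r. m (X r x)) = integral {0..t} (\<lambda>r. m (X r x))"
    using assms by (intro Henstock_Kurzweil_Integration.integral_combine integrable_continuous_real drift_cont) auto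
  then show ?thesis
    using assms by (simp add: flow_eq[of t] flow_eq[of s] algebra_simps)
qed

text \<open>The noise cancels in the difference of two solutions, which is therefore differentiable
  in time although each path is only continuous.\<close>

lemma flow_stable:
  assumes T: "0 \<le> T" and L: "0 \<le> L"
    and lip: "\<And>x y. x \<in> cball 0 R \<Longrightarrow> y \<in> cball 0 R \<Longrightarrow> norm (m x - m y) \<le> L * norm (x - y)"
    and x: "\<And>s. s \<in> {0..T} \<Longrightarrow> X s x \<in> cball 0 R"
    and y: "\<And>s. s \<in> {0..T} \<Longrightarrow> X s y \<in> cball 0 R"
  shows "norm (X T x - X T y) \<le> exp (L * T) * norm (x - y)"
    and "norm (x - y) \<le> exp (L * T) * norm (X T x - X T y)"
proof -
  have deriv: "((\<lambda>s. X s x - X s y) has_vector_derivative m (X s x) - m (X s y)) (at s within {0..T})"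
    if "s \<in> {0..T}" for s
  proof (rule has_vector_derivative_transform[OF that])
    show "((\<lambda>s. (x - y) + (integral {0..s} (\<lambda>s. m (X s x)) - integral {0..s} (\<lambda>s. m (X s y))))
        has_vector_derivative m (X s x) - m (X s y)) (at s within {0..T})"
    proof -
      have "((\<lambda>s. integral {0..s} (\<lambda>s. m (X s x)) - integral {0..s} (\<lambda>s. m (X s y)))
        has_vector_derivative m (X s x) - m (X s y)) (at s within {0..T})"
        by (intro has_vector_derivative_diff integral_has_vector_derivative drift_cont that) auto
      from has_vector_derivative_add[OF has_vector_derivative_const this]
      show ?thesis by simp
    qed
  qed (simp add: flow_eq algebra_simps)
  note * = norm_growth_bounds[OF T L deriv lip[OF x y], simplified flow_0]
  show "norm (X T x - X T y) \<le> exp (L * T) * norm (x - y)"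
    and "norm (x - y) \<le> exp (L * T) * norm (X T x - X T y)"
    using * by auto
qed

lemma path_bounded: "\<exists>R. \<forall>s\<in>{0..T}. X s x \<in> cball 0 R"
proof -
  have "bounded ((\<lambda>s. X s x) ` {0..T})"
    by (intro compact_imp_bounded compact_continuous_image continuous_on_subset[OF flow_cont]) auto
  then show ?thesis
    by (auto simp: bounded_iff)
qed

lemma flow_inj:
  assumes "0 \<le> T" shows "inj (X T)"
proof (rule injI)
  fix x y assume eq: "X T x = X T y"
  obtain R1 R2 where R: "\<forall>s\<in>{0..T}. X s x \<in> cball 0 R1" "\<forall>s\<in>{0..T}. X s y \<in> cball 0 R2"
    using path_bounded by meson
  obtain L where L: "L \<ge> 0"
    "\<forall>x\<in>cball 0 (max R1 R2). \<forall>y\<in>cball 0 (max R1 R2). norm (m x - m y) \<le> L * norm (x - y)"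
    using m_lipschitz by blast
  have "norm (x - y) \<le> exp (L * T) * norm (X T x - X T y)"
    by (rule flow_stable(2)[OF assms L(1), of "max R1 R2"]) (use R L(2) in force)+
  then show "x = y" using eq by simp
qed

text \<open>A bootstrap: as long as the two paths are within distance 1, both lie in a ball with
  Lipschitz constant \<open>L\<close>, so their distance is at most \<open>exp (L * T)\<close> times
  the initial one. With \<delta> the inverse of this factor, the distance can never reach 1.\<close>

lemma flow_locally_stable:
  assumes T: "0 \<le> T"
  obtains \<delta> R L where "\<delta> > 0" "L \<ge> 0"
    "\<And>x s. x \<in> ball x0 \<delta> \<Longrightarrow> s \<in> {0..T} \<Longrightarrow> X s x \<in> cball 0 R"
    "\<And>x s. x \<in> ball x0 \<delta> \<Longrightarrow> s \<in> {0..T} \<Longrightarrow> norm (X s x - X s x0) \<le> L * norm (x - x0)"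
proof -
  obtain R0 where R0: "\<forall>s\<in>{0..T}. X s x0 \<in> cball 0 R0"
    using path_bounded by blast
  obtain L where L: "L \<ge> 0"
    "\<And>x y. x \<in> cball 0 (R0 + 1) \<Longrightarrow> y \<in> cball 0 (R0 + 1) \<Longrightarrow> norm (m x - m y) \<le> L * norm (x - y)"
    using m_lipschitz by blast
  define \<delta> where "\<delta> = exp (- L * T)"
  have \<delta>: "\<delta> > 0" "\<delta> \<le> 1" using L(1) T by (auto simp: \<delta>_def)
  have stab: "norm (X s x - X s x0) \<le> exp (L * s) * norm (x - x0)"
    if s: "0 \<le> s" "s \<le> T" and le: "\<And>r. r \<in> {0..s} \<Longrightarrow> norm (X r x - X r x0) \<le> 1" for s x
  proof (rule flow_stable(1)[OF s(1) L])
    fix r assume r: "r \<in> {0..s}"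
    then have n: "norm (X r x0) \<le> R0" using R0 s by auto
    then show "X r x0 \<in> cball 0 (R0 + 1)" by simp
    have "norm (X r x) \<le> norm (X r x - X r x0) + norm (X r x0)" using norm_triangle_sub[of "X r x" "X r x0"] by simp
    then show "X r x \<in> cball 0 (R0 + 1)" using le[OF r] n by simp
  qed
  have close: "norm (X s x - X s x0) < 1" if x: "x \<in> ball x0 \<delta>" and s: "s \<in> {0..T}" for x s
  proof (rule ccontr)
    assume neg: "\<not> norm (X s x - X s x0) < 1"
    let ?f = "\<lambda>s. norm (X s x - X s x0)"
    let ?B = "{0..T} \<inter> ?f -` {1..}"
    have contf: "continuous_on {0..T} ?f"
      by (intro continuous_intros continuous_on_subset[OF flow_cont]) auto
    have "compact ?B"
      using continuous_closed_preimage[OF contf, of "{1..}"]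
      by (auto simp: compact_eq_bounded_closed intro: bounded_subset[of "{0..T}"])
    moreover have "?B \<noteq> {}" using s neg by auto
    \<comment> \<open>\<open>r\<close> is the first time at which the distance reaches 1.\<close>
    ultimately obtain r where r: "r \<in> ?B" "\<And>q. q \<in> ?B \<Longrightarrow> r \<le> q"
      using compact_attains_inf[of ?B] by blast
    have lt: "?f q < 1" if "q \<in> {0..<r}" for q
      using r(2)[of q] that r(1) by force
    have f0: "?f 0 < 1" using x \<delta> by (simp add: flow_0 dist_norm norm_minus_commute)
    then have "r \<noteq> 0" using r(1) by auto
    then have r0: "0 < r" "r \<le> T" using r(1) by auto
    \<comment> \<open>\<open>stab\<close> needs the bound on the closed interval up to
      \<open>r\<close>; at the endpoint it follows from continuity.\<close>
    have "?f r \<le> 1"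
    proof (rule continuous_le_on_closure[of "{0..<r}" ?f r])
      show "continuous_on (closure {0..<r}) ?f"
        using r0 by (auto intro!: continuous_on_subset[OF contf])
    qed (use r0 lt in \<open>auto simp: less_imp_le\<close>)
    then have "?f q \<le> 1" if "q \<in> {0..r}" for q
      using lt[of q] that by (cases "q = r") auto
    then have "?f r \<le> exp (L * r) * norm (x - x0)"
      using r0 by (intro stab) auto
    also have "\<dots> \<le> exp (L * T) * norm (x - x0)"
      using r0 L(1) by (intro mult_right_mono) (auto simp: mult_left_mono)
    also have "\<dots> < exp (L * T) * \<delta>"
      using x by (simp add: dist_norm norm_minus_commute)
    also have "\<dots> = 1" by (simp add: \<delta>_def exp_minus)
    finally show False using r(1) by auto
  qed
  show thesis
  proof (rule that[OF \<delta>(1), where L = "exp (L * T)" and R = "R0 + 1"])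
    fix x s assume x: "x \<in> ball x0 \<delta>" and s: "s \<in> {0..T}"
    have "norm (X s x) \<le> norm (X s x - X s x0) + norm (X s x0)" using norm_triangle_sub[of "X s x" "X s x0"] by simp
    then show "X s x \<in> cball 0 (R0 + 1)" using close[OF x s] R0 s by force
    have "norm (X s x - X s x0) \<le> exp (L * s) * norm (x - x0)"
      by (rule stab) (use s close[OF x] in \<open>auto simp: less_imp_le\<close>)
    also have "\<dots> \<le> exp (L * T) * norm (x - x0)"
      using s L(1) by (intro mult_right_mono) (auto simp: mult_left_mono)
    finally show "norm (X s x - X s x0) \<le> exp (L * T) * norm (x - x0)" .
  qed simp
qed

lemma flow_space_cont:
  assumes "0 \<le> T" shows "continuous_on UNIV (X T)"
proof (rule continuous_at_imp_continuous_on, rule ballI)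
  fix x0
  obtain \<delta> R L where d: "\<delta> > 0" "L \<ge> 0"
    "\<And>x s. x \<in> ball x0 \<delta> \<Longrightarrow> s \<in> {0..T} \<Longrightarrow> norm (X s x - X s x0) \<le> L * norm (x - x0)"
    by (rule flow_locally_stable[OF assms, of x0]) blast
  have "((\<lambda>x. L * norm (x - x0)) \<longlongrightarrow> 0) (at x0)"
    by (auto intro!: tendsto_eq_intros)
  then have "((\<lambda>x. X T x - X T x0) \<longlongrightarrow> 0) (at x0)"
  proof (rule Lim_null_comparison[rotated])
    show "\<forall>\<^sub>F x in at x0. norm (X T x - X T x0) \<le> L * norm (x - x0)"
      using d assms unfolding eventually_at by (auto simp: dist_commute intro!: exI[of _ \<delta>])
  qed
  then show "isCont (X T) x0"
    by (simp add: isCont_def LIM_zero_iff)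
qed

lemma flow_bounded_on_compact:
  assumes "0 \<le> T" "compact K"
  obtains R where "\<And>x s. x \<in> K \<Longrightarrow> s \<in> {0..T} \<Longrightarrow> X s x \<in> cball 0 R"
proof -
  have "\<exists>\<delta> R. \<delta> > 0 \<and> (\<forall>x\<in>ball x0 \<delta>. \<forall>s\<in>{0..T}. X s x \<in> cball 0 R)" for x0
    by (rule flow_locally_stable[OF assms(1), of x0]) blast
  then obtain \<delta> R where dR: "\<And>x0. \<delta> x0 > 0" "\<And>x0 x s. x \<in> ball x0 (\<delta> x0) \<Longrightarrow> s \<in> {0..T} \<Longrightarrow> X s x \<in> cball 0 (R x0)"
    by metis
  obtain C where C: "finite C" "K \<subseteq> (\<Union>x\<in>C. ball x (\<delta> x))"
  proof (rule compactE_image[OF assms(2), of K "\<lambda>x. ball x (\<delta> x)"])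
    show "K \<subseteq> (\<Union>x\<in>K. ball x (\<delta> x))" using dR(1) by force
  qed auto
  show thesis
  proof
    fix x s assume x: "x \<in> K" "s \<in> {0..T}"
    then obtain c where c: "c \<in> C" "x \<in> ball c (\<delta> c)" using C by auto
    then have "norm (X s x) \<le> R c" using dR(2)[OF c(2) x(2)] by simp
    also have "\<dots> \<le> Max (R ` C)" using c C by (intro Max_ge) auto
    finally show "X s x \<in> cball 0 (Max (R ` C))" by simp
  qed
qed

text \<open>Scheme and flow receive the same noise increment in each step, so the error changes only
  by the integral of \<open>m\<close> at the grid value minus \<open>m\<close> along the path. This
  is at most \<open>L * h\<close> times the current error plus the oscillation \<rho> of the path
  over one step. All constants are uniform over starting points in \<open>cball 0 r\<close>.\<close>

lemma euler_converges:
  assumes T: "0 \<le> T" and e: "0 < e"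
  obtains h0 R where "h0 > 0"
    "\<And>h x t j. 0 < h \<Longrightarrow> h \<le> h0 \<Longrightarrow> x \<in> cball 0 r \<Longrightarrow> t \<in> {0..T} \<Longrightarrow> j \<le> nat \<lfloor>t / h\<rfloor> \<Longrightarrow>
       euler m h (\<lambda>i. \<beta> (real (Suc i) * h) - \<beta> (real i * h)) j x \<in> cball 0 R"
    "\<And>h x t. 0 < h \<Longrightarrow> h \<le> h0 \<Longrightarrow> x \<in> cball 0 r \<Longrightarrow> t \<in> {0..T} \<Longrightarrow>
       norm (euler m h (\<lambda>i. \<beta> (real (Suc i) * h) - \<beta> (real i * h)) (nat \<lfloor>t / h\<rfloor>) x - X t x) \<le> e"
proof -
  obtain R0 where R0: "\<And>x s. x \<in> cball 0 r \<Longrightarrow> s \<in> {0..T} \<Longrightarrow> X s x \<in> cball 0 R0"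
    using flow_bounded_on_compact[OF T, of "cball 0 r"] by auto
  obtain L where L: "L \<ge> 0"
    "\<And>x y. x \<in> cball 0 (R0 + 1) \<Longrightarrow> y \<in> cball 0 (R0 + 1) \<Longrightarrow> norm (m x - m y) \<le> L * norm (x - y)"
    using m_lipschitz by blast
  have "bounded (m ` cball 0 R0)"
    by (intro compact_imp_bounded compact_continuous_image continuous_on_subset[OF m_cont]) auto
  then obtain K where K: "K > 0" "\<And>x. x \<in> cball 0 R0 \<Longrightarrow> norm (m x) \<le> K"
    by (auto simp: bounded_pos)
  \<comment> \<open>The accumulated error stays below \<open>\<rho> * exp (L * T)\<close>. The bound
    1 keeps the scheme inside the ball where \<open>L\<close> is valid; half of \<open>e\<close> is
    reserved for rounding \<open>t\<close> down to the grid.\<close>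
  define \<rho> where "\<rho> = min e 1 / (2 * exp (L * T))"
  have \<rho>: "\<rho> > 0" using e by (simp add: \<rho>_def)
  have "uniformly_continuous_on {0..T} \<beta>"
    by (intro compact_uniformly_continuous continuous_on_subset[OF noise_cont]) auto
  then obtain d where d: "d > 0" "\<And>s t. s \<in> {0..T} \<Longrightarrow> t \<in> {0..T} \<Longrightarrow> dist t s < d \<Longrightarrow> dist (\<beta> t) (\<beta> s) < \<rho> / 2"
    using \<rho> unfolding uniformly_continuous_on_def by (metis half_gt_zero)
  \<comment> \<open>Over a step of this length the noise and the drift each contribute at most
    \<rho>/2 to the oscillation.\<close>
  define h0 where "h0 = min (d / 2) (\<rho> / (2 * K))"
  have h0: "h0 > 0" "h0 < d" "K * h0 \<le> \<rho> / 2"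
    using d \<rho> K by (auto simp: h0_def min_def field_simps)
  have osc: "norm (X t x - X s x) \<le> \<rho>"
    if x: "x \<in> cball 0 r" and st: "0 \<le> s" "s \<le> t" "t \<le> T" "t - s \<le> h0" for x s t
  proof -
    have "norm (integral {s..t} (\<lambda>r. m (X r x))) \<le> K * (t - s)"
      using st x by (intro integral_bound drift_cont K(2) R0) auto
    also have "\<dots> \<le> K * h0" using st K by (intro mult_left_mono) auto
    finally have 1: "norm (integral {s..t} (\<lambda>r. m (X r x))) \<le> \<rho> / 2" using h0 by simp
    have "norm (\<beta> t - \<beta> s) \<le> \<rho> / 2"
      using d(2)[of s t] st h0 by (simp add: dist_norm less_imp_le)
    then show ?thesis
      unfolding flow_diff_eq[OF st(1,2)] using 1 norm_triangle_ineq[of "\<beta> t - \<beta> s" "integral {s..t} (\<lambda>r. m (X r x))"]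
      by linarith
  qed
  \<comment> \<open>\<open>\<rho> * (1 + L * h) ^ k - \<rho>\<close> is the exact solution, starting
    from 0, of the error recursion that multiplies by \<open>1 + L * h\<close> and adds
    \<open>L * h * \<rho>\<close>.\<close>
  have key: "norm (euler m h (\<lambda>i. \<beta> (real (Suc i) * h) - \<beta> (real i * h)) k x - X (real k * h) x) \<le> \<rho> * (1 + L * h) ^ k - \<rho> \<and>
      \<rho> * (1 + L * h) ^ k \<le> \<rho> * exp (L * T)"
    if h: "0 < h" "h \<le> h0" and x: "x \<in> cball 0 r" and k: "real k * h \<le> T" for h x k
    using k
  proof (induction k)
    case 0
    then show ?case using L(1) T \<rho> by (simp add: flow_0)
  next
    case (Suc k)
    let ?E = "\<lambda>k. euler m h (\<lambda>i. \<beta> (real (Suc i) * h) - \<beta> (real i * h)) k x"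
    let ?s = "real k * h" and ?t = "real (Suc k) * h"
    have st: "0 \<le> ?s" "?s \<le> ?t" "?t \<le> T" "?t - ?s = h" using h Suc.prems by (auto simp: algebra_simps)
    have IH: "norm (?E k - X ?s x) \<le> \<rho> * (1 + L * h) ^ k - \<rho>" "\<rho> * (1 + L * h) ^ k \<le> \<rho> * exp (L * T)"
      using Suc.IH st by auto
    have "(1 + L * h) ^ Suc k \<le> exp (L * h) ^ Suc k"
      using L(1) h by (intro power_mono) (auto simp: exp_ge_add_one_self add.commute)
    also have "\<dots> = exp (L * ?t)" by (subst exp_of_nat_mult[symmetric]) (simp add: algebra_simps)
    also have "\<dots> \<le> exp (L * T)" using st L(1) by (simp add: mult_left_mono)
    finally have bound: "\<rho> * (1 + L * h) ^ Suc k \<le> \<rho> * exp (L * T)" using \<rho> by simp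
    have "\<rho> * exp (L * T) \<le> 1" by (simp add: \<rho>_def min_def)
    then have close: "norm (?E k - X ?s x) \<le> 1" using IH \<rho> by linarith
    have "norm (X ?s x) \<le> R0" using R0[OF x, of ?s] st by simp
    then have Ein: "?E k \<in> cball 0 (R0 + 1)"
      using close norm_triangle_sub[of "?E k" "X ?s x"] by simp
    have "?E (Suc k) - X ?t x = (?E k - X ?s x) + (h *\<^sub>R m (?E k) - integral {?s..?t} (\<lambda>r. m (X r x)))"
      using flow_diff_eq[OF st(1,2), of x] by (simp add: algebra_simps)
    also have "h *\<^sub>R m (?E k) = integral {?s..?t} (\<lambda>r. m (?E k))"
      using st by simp
    also have "integral {?s..?t} (\<lambda>r. m (?E k)) - integral {?s..?t} (\<lambda>r. m (X r x)) = integral {?s..?t} (\<lambda>r. m (?E k) - m (X r x))"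
      using st by (intro Henstock_Kurzweil_Integration.integral_diff[symmetric] integrable_continuous_real drift_cont) auto
    finally have eq: "?E (Suc k) - X ?t x = (?E k - X ?s x) + integral {?s..?t} (\<lambda>r. m (?E k) - m (X r x))" .
    have "norm (integral {?s..?t} (\<lambda>r. m (?E k) - m (X r x))) \<le> (L * (norm (?E k - X ?s x) + \<rho>)) * (?t - ?s)"
    proof (rule integral_bound[OF st(2)])
      show "continuous_on {?s..?t} (\<lambda>r. m (?E k) - m (X r x))"
        using st by (intro continuous_intros drift_cont)
      fix q assume q: "q \<in> {?s..?t}"
      have "q \<in> {0..T}" using q st(1,3) by (meson atLeastAtMost_iff order_trans)
      then have "X q x \<in> cball 0 (R0 + 1)" using R0[OF x, of q] by simp
      then have "norm (m (?E k) - m (X q x)) \<le> L * norm (?E k - X q x)"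
        by (rule L(2)[OF Ein])
      also have "norm (?E k - X q x) \<le> norm (?E k - X ?s x) + \<rho>"
        using osc[OF x, of ?s q] q st h norm_triangle_ineq[of "?E k - X ?s x" "X ?s x - X q x"]
        by (simp add: norm_minus_commute)
      finally show "norm (m (?E k) - m (X q x)) \<le> L * (norm (?E k - X ?s x) + \<rho>)"
        using L(1) by (simp add: mult_left_mono)
    qed
    then have int: "norm (integral {?s..?t} (\<lambda>r. m (?E k) - m (X r x))) \<le> L * h * (norm (?E k - X ?s x) + \<rho>)"
      unfolding st(4) by (simp only: mult_ac)
    have "norm (?E (Suc k) - X ?t x) \<le> norm (?E k - X ?s x) + norm (integral {?s..?t} (\<lambda>r. m (?E k) - m (X r x)))"
      unfolding eq by (rule norm_triangle_ineq)
    also have "\<dots> \<le> norm (?E k - X ?s x) + L * h * (norm (?E k - X ?s x) + \<rho>)"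
      using int by simp
    also have "\<dots> = (1 + L * h) * norm (?E k - X ?s x) + L * h * \<rho>" by (simp add: algebra_simps)
    also have "\<dots> \<le> (1 + L * h) * (\<rho> * (1 + L * h) ^ k - \<rho>) + L * h * \<rho>"
      using IH L(1) h by (intro add_right_mono mult_left_mono) auto
    also have "\<dots> = \<rho> * (1 + L * h) ^ Suc k - \<rho>" by (simp add: algebra_simps)
    finally show ?case using bound by blast
  qed
  have \<rho>e: "\<rho> * exp (L * T) \<le> e / 2" "\<rho> * exp (L * T) \<le> 1" by (auto simp: \<rho>_def min_def)
  have \<rho>2: "\<rho> \<le> \<rho> * exp (L * T)" using \<rho> L(1) T by simp
  show thesis
  proof (rule that[OF h0(1), where R = "R0 + 1"])
    fix h t and x :: 'a and j assume h: "0 < h" "h \<le> h0" and x: "x \<in> cball 0 r" and t: "t \<in> {0..T}" and j: "j \<le> nat \<lfloor>t / h\<rfloor>"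
    have "real j \<le> t / h" using j t h by (simp add: le_nat_iff le_floor_iff)
    then have jT: "real j * h \<le> T" using h t by (simp add: field_simps)
    note k = key[OF h x this]
    have "norm (X (real j * h) x) \<le> R0" using R0[OF x, of "real j * h"] h jT by simp
    then show "euler m h (\<lambda>i. \<beta> (real (Suc i) * h) - \<beta> (real i * h)) j x \<in> cball 0 (R0 + 1)"
      using norm_triangle_sub[of "euler m h (\<lambda>i. \<beta> (real (Suc i) * h) - \<beta> (real i * h)) j x" "X (real j * h) x"] k \<rho>e \<rho>
      by (simp only: mem_cball_0) linarith
  next
    fix h t and x :: 'a assume h: "0 < h" "h \<le> h0" and x: "x \<in> cball 0 r" and t: "t \<in> {0..T}"
    define k where "k = nat \<lfloor>t / h\<rfloor>"
    have "real k \<le> t / h" "t / h < real k + 1" using t h by (auto simp: k_def of_nat_nat)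
    then have kt: "real k * h \<le> t" "t - real k * h \<le> h" using h by (auto simp: field_simps)
    have "norm (X t x - X (real k * h) x) \<le> \<rho>" using osc[OF x, of "real k * h" t] kt h t by simp
    then show "norm (euler m h (\<lambda>i. \<beta> (real (Suc i) * h) - \<beta> (real i * h)) (nat \<lfloor>t / h\<rfloor>) x - X t x) \<le> e"
      using key[OF h x, of k] kt t e \<rho>e \<rho>2 norm_triangle_ineq[of "euler m h (\<lambda>i. \<beta> (real (Suc i) * h) - \<beta> (real i * h)) k x - X (real k * h) x" "X (real k * h) x - X t x"]
      unfolding k_def[symmetric] by (simp add: norm_minus_commute)
  qed
qed

end

section \<open>Expansion of one Euler step\<close>

text \<open>A further factor multiplies the old error by at most \<open>1 + K\<close> and creates
  one new term, \<open>h\<^sup>2 * (B j * ?S)\<close>. The constant depends on \<open>K\<close> and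
  on the index set, but not on \<open>B\<close>.\<close>

lemma prod_near_one:
  fixes I :: "'i set" and K :: real
  assumes "finite I" "K \<ge> 0"
  shows "\<exists>C\<ge>0. \<forall>(B :: 'i \<Rightarrow> real) h. (\<forall>i\<in>I. \<bar>B i\<bar> \<le> K) \<longrightarrow> 0 \<le> h \<longrightarrow> h \<le> 1 \<longrightarrow>
    \<bar>(\<Prod>i\<in>I. 1 + h * B i) - (1 + h * (\<Sum>i\<in>I. B i))\<bar> \<le> C * h\<^sup>2"
  using assms(1)
proof (induction rule: finite_induct)
  case empty
  show ?case by (intro exI[of _ 0]) auto
next
  case (insert j I)
  then obtain C where C: "C \<ge> 0" "\<And>(B :: 'i \<Rightarrow> real) h. (\<forall>i\<in>I. \<bar>B i\<bar> \<le> K) \<Longrightarrow> 0 \<le> h \<Longrightarrow> h \<le> 1 \<Longrightarrow>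
    \<bar>(\<Prod>i\<in>I. 1 + h * B i) - (1 + h * (\<Sum>i\<in>I. B i))\<bar> \<le> C * h\<^sup>2" by blast
  show ?case
  proof (intro exI[of _ "(1 + K) * C + K * (of_nat (card I) * K)"] conjI allI impI)
    show "0 \<le> (1 + K) * C + K * (of_nat (card I) * K)" using C(1) assms(2) by simp
    fix B :: "'i \<Rightarrow> real" and h :: real assume B: "\<forall>i\<in>insert j I. \<bar>B i\<bar> \<le> K" and h: "0 \<le> h" "h \<le> 1"
    let ?P = "\<Prod>i\<in>I. 1 + h * B i" and ?S = "\<Sum>i\<in>I. B i"
    have IH: "\<bar>?P - (1 + h * ?S)\<bar> \<le> C * h\<^sup>2" using C(2) B h by auto
    have "\<bar>?S\<bar> \<le> (\<Sum>i\<in>I. \<bar>B i\<bar>)" by (rule sum_abs)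
    also have "\<dots> \<le> of_nat (card I) * K" using B by (intro sum_bounded_above) auto
    finally have S: "\<bar>?S\<bar> \<le> of_nat (card I) * K" .
    have Bj: "\<bar>B j\<bar> \<le> K" using B by simp
    have "\<bar>1 + h * B j\<bar> \<le> 1 + K"
    proof -
      have "\<bar>h * B j\<bar> \<le> 1 * K" unfolding abs_mult using h Bj by (intro mult_mono) auto
      then show ?thesis by linarith
    qed
    then have 1: "\<bar>(1 + h * B j) * (?P - (1 + h * ?S))\<bar> \<le> (1 + K) * (C * h\<^sup>2)"
      unfolding abs_mult using IH assms(2) by (intro mult_mono) auto
    have "\<bar>B j * ?S\<bar> \<le> K * (of_nat (card I) * K)"
      unfolding abs_mult using S Bj assms(2) by (intro mult_mono) auto
    then have 2: "\<bar>h\<^sup>2 * (B j * ?S)\<bar> \<le> K * (of_nat (card I) * K) * h\<^sup>2"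
      by (subst abs_mult, subst mult.commute) (auto intro: mult_right_mono)
    have "(\<Prod>i\<in>insert j I. 1 + h * B i) - (1 + h * (\<Sum>i\<in>insert j I. B i)) =
       (1 + h * B j) * (?P - (1 + h * ?S)) + h\<^sup>2 * (B j * ?S)"
      using insert.hyps by (simp add: algebra_simps power2_eq_square)
    then show "\<bar>(\<Prod>i\<in>insert j I. 1 + h * B i) - (1 + h * (\<Sum>i\<in>insert j I. B i))\<bar>
       \<le> ((1 + K) * C + K * (of_nat (card I) * K)) * h\<^sup>2"
      using 1 2 by (simp add: algebra_simps)
  qed
qed

text \<open>In the Leibniz formula the identity permutation gives the product treated by
  \<open>prod_near_one\<close>. Any other \<open>p\<close> moves some \<open>a\<close> and then also
  \<open>p a\<close>, so its term contains two off-diagonal factors of order \<open>h\<close> and is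
  of order \<open>h\<^sup>2\<close>.\<close>

lemma det_near_identity:
  assumes K: "K \<ge> 0"
  shows "\<exists>C\<ge>0. \<forall>(B::real^'n^'n) h. (\<forall>i j. \<bar>B $ i $ j\<bar> \<le> K) \<longrightarrow> 0 \<le> h \<longrightarrow> h \<le> 1 \<longrightarrow>
    \<bar>det (mat 1 + h *\<^sub>R B) - (1 + h * trace B)\<bar> \<le> C * h\<^sup>2"
proof -
  obtain C1 where C1: "C1 \<ge> 0" "\<And>(B::'n \<Rightarrow> real) h. (\<forall>i. \<bar>B i\<bar> \<le> K) \<Longrightarrow> 0 \<le> h \<Longrightarrow> h \<le> 1 \<Longrightarrow>
    \<bar>(\<Prod>i\<in>UNIV. 1 + h * B i) - (1 + h * (\<Sum>i\<in>UNIV. B i))\<bar> \<le> C1 * h\<^sup>2"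
    using prod_near_one[of "UNIV :: 'n set" K] K by auto
  let ?P = "{p. p permutes (UNIV :: 'n set)}"
  define C2 where "C2 = of_nat (card (?P - {id})) * (1 + K) ^ CARD('n)"
  have C2: "C2 \<ge> 0" using K by (simp add: C2_def)
  have "\<bar>det (mat 1 + h *\<^sub>R B) - (1 + h * trace B)\<bar> \<le> (C1 + C2) * h\<^sup>2"
    if B: "\<forall>i j. \<bar>B $ i $ j\<bar> \<le> K" and h: "0 \<le> h" "h \<le> 1" for B :: "real^'n^'n" and h
  proof -
    let ?A = "mat 1 + h *\<^sub>R B"
    let ?t = "\<lambda>p. of_int (sign p) * (\<Prod>i\<in>UNIV. ?A $ i $ p i)"
    have small: "\<bar>?t p\<bar> \<le> (1 + K) ^ CARD('n) * h\<^sup>2" if p: "p \<in> ?P - {id}" for p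
    proof -
      obtain a where a: "p a \<noteq> a" using p by (auto simp: fun_eq_iff)
      have pa: "p (p a) \<noteq> p a" using a p permutes_inj by (metis Diff_iff injD mem_Collect_eq)
      have hB: "\<bar>h * B $ i $ j\<bar> \<le> h * K" for i j
        unfolding abs_mult using B h by (intro mult_mono) auto
      have hK: "h * K \<le> K" using mult_right_mono[OF h(2) K] by simp
      have "\<bar>?t p\<bar> = (\<Prod>i\<in>UNIV. \<bar>?A $ i $ p i\<bar>)"
        by (simp add: abs_mult abs_prod sign_def)
      also have "\<dots> = (\<Prod>i\<in>{a, p a}. \<bar>?A $ i $ p i\<bar>) * (\<Prod>i\<in>UNIV - {a, p a}. \<bar>?A $ i $ p i\<bar>)"
        by (subst prod.subset_diff[of "{a, p a}"]) (auto simp: mult.commute)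
      also have "\<dots> \<le> (\<Prod>i\<in>{a, p a}. h * (1 + K)) * (\<Prod>i\<in>UNIV - {a, p a}. 1 + K)"
      proof (intro mult_mono prod_mono conjI)
        fix i assume i: "i \<in> {a, p a}"
        then have "p i \<noteq> i" using a pa by auto
        then show "\<bar>?A $ i $ p i\<bar> \<le> h * (1 + K)"
          using hB[of i "p i"] h by (simp add: mat_def algebra_simps)
      next
        fix i
        have "\<bar>?A $ i $ p i\<bar> \<le> 1 + \<bar>h * B $ i $ p i\<bar>"
          by (auto simp: mat_def)
        then show "\<bar>?A $ i $ p i\<bar> \<le> 1 + K" using hB[of i "p i"] hK by linarith
      qed (use h K in \<open>auto intro!: prod_nonneg\<close>)
      also have "\<dots> = h\<^sup>2 * ((\<Prod>i\<in>{a, p a}. 1 + K) * (\<Prod>i\<in>UNIV - {a, p a}. 1 + K))"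
        using a by (simp add: power2_eq_square)
      also have "(\<Prod>i\<in>{a, p a}. 1 + K) * (\<Prod>i\<in>UNIV - {a, p a}. 1 + K) = (\<Prod>i\<in>(UNIV::'n set). 1 + K)"
        by (subst prod.subset_diff[of "{a, p a}" "UNIV :: 'n set"]) (auto simp: mult.commute)
      finally show ?thesis by (simp add: mult.commute)
    qed
    have "det ?A = (\<Sum>p\<in>?P. ?t p)" by (simp add: det_def)
    also have "\<dots> = ?t id + (\<Sum>p\<in>?P - {id}. ?t p)"
      by (rule sum.remove) (auto simp: permutes_id)
    also have "?t id = (\<Prod>i\<in>UNIV. 1 + h * B $ i $ i)" by (simp add: mat_def)
    finally have det: "det ?A = (\<Prod>i\<in>UNIV. 1 + h * B $ i $ i) + (\<Sum>p\<in>?P - {id}. ?t p)" .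
    have "\<bar>\<Sum>p\<in>?P - {id}. ?t p\<bar> \<le> (\<Sum>p\<in>?P - {id}. \<bar>?t p\<bar>)" by (rule sum_abs)
    also have "\<dots> \<le> of_nat (card (?P - {id})) * ((1 + K) ^ CARD('n) * h\<^sup>2)"
      by (rule sum_bounded_above) (rule small)
    finally have 2: "\<bar>\<Sum>p\<in>?P - {id}. ?t p\<bar> \<le> C2 * h\<^sup>2" by (simp add: C2_def)
    have 1: "\<bar>(\<Prod>i\<in>UNIV. 1 + h * B $ i $ i) - (1 + h * trace B)\<bar> \<le> C1 * h\<^sup>2"
      using C1(2)[of "\<lambda>i. B $ i $ i" h] B h by (simp add: trace_def)
    show ?thesis
      using 1 2 unfolding det by (simp add: algebra_simps)
  qed
  then show ?thesis using C1(1) C2 by (intro exI[of _ "C1 + C2"]) auto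
qed

lemma continuous_bounded_cball:
  fixes f :: "'a::euclidean_space \<Rightarrow> 'b::real_normed_vector"
  assumes "continuous_on UNIV f"
  obtains K where "K > 0" "\<And>x. x \<in> cball 0 R \<Longrightarrow> norm (f x) \<le> K"
proof -
  have "bounded (f ` cball 0 R)"
    by (intro compact_imp_bounded compact_continuous_image continuous_on_subset[OF assms]) auto
  then show thesis using that by (auto simp: bounded_pos)
qed

section \<open>Regularity of the drift and of u, and Taylor expansion\<close>

lemma C11_has_derivative:
  assumes "C11 m"
  shows "(m has_derivative frechet_derivative m (at x)) (at x)"
  using assms frechet_derivative_works by (auto simp: C11_def)

lemma C11_continuous: "C11 m \<Longrightarrow> continuous_on S m"
  by (meson C11_has_derivative continuous_at_imp_continuous_on has_derivative_continuous)

lemma C11_continuous_jacobian: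
  assumes "C11 m"
  shows "continuous_on UNIV (\<lambda>x. matrix (frechet_derivative m (at x)))"
proof -
  obtain L where L: "\<And>x y v. norm (frechet_derivative m (at x) v - frechet_derivative m (at y) v) \<le> L * dist x y * norm v"
    using assms by (auto simp: C11_def)
  have "continuous_on UNIV (\<lambda>x. frechet_derivative m (at x) v)" for v
  proof -
    have "(\<bar>L\<bar> * norm v)-lipschitz_on UNIV (\<lambda>x. frechet_derivative m (at x) v)"
    proof (rule lipschitz_onI)
      fix x y :: "real^'a"
      have "L * dist x y * norm v \<le> \<bar>L\<bar> * dist x y * norm v"
        by (intro mult_right_mono) auto
      then show "dist (frechet_derivative m (at x) v) (frechet_derivative m (at y) v) \<le> \<bar>L\<bar> * norm v * dist x y"
        using L[of x v y] by (simp add: dist_norm mult_ac)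
    qed simp
    then show ?thesis by (rule lipschitz_on_continuous_on)
  qed
  then show ?thesis
    unfolding matrix_def by (intro continuous_intros)
qed

text \<open>On the ball the derivative differs from the one at 0 by at most
  \<open>\<bar>L\<bar> * \<bar>R\<bar>\<close> in operator norm; the mean value inequality does the
  rest.\<close>

lemma C11_lipschitz_cball:
  assumes "C11 m"
  shows "\<exists>L\<ge>0. \<forall>x\<in>cball 0 R. \<forall>y\<in>cball 0 R. norm (m x - m y) \<le> L * norm (x - y)"
proof -
  obtain L where L: "\<And>x y v. norm (frechet_derivative m (at x) v - frechet_derivative m (at y) v) \<le> L * dist x y * norm v"
    using assms by (auto simp: C11_def)
  let ?B = "onorm (frechet_derivative m (at 0)) + \<bar>L\<bar> * \<bar>R\<bar>"
  have bl: "bounded_linear (frechet_derivative m (at x))" for x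
    using C11_has_derivative[OF assms] has_derivative_bounded_linear by blast
  have "norm (m x - m y) \<le> ?B * norm (x - y)" if "x \<in> cball 0 R" "y \<in> cball 0 R" for x y
  proof (rule differentiable_bound[OF convex_cball[of 0 R]])
    fix z :: "real^'a" assume z: "z \<in> cball 0 R"
    show "(m has_derivative frechet_derivative m (at z)) (at z within cball 0 R)"
      by (rule has_derivative_at_withinI[OF C11_has_derivative[OF assms]])
    show "onorm (frechet_derivative m (at z)) \<le> ?B"
    proof (rule onorm_le)
      fix v
      have "norm (frechet_derivative m (at z) v) \<le> norm (frechet_derivative m (at 0) v) + L * norm z * norm v"
        using L[of z v 0] norm_triangle_sub[of "frechet_derivative m (at z) v" "frechet_derivative m (at 0) v"] by simp
      also have "norm (frechet_derivative m (at 0) v) \<le> onorm (frechet_derivative m (at 0)) * norm v"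
        by (rule onorm[OF bl])
      also have "L * norm z * norm v \<le> \<bar>L\<bar> * \<bar>R\<bar> * norm v"
      proof (rule mult_right_mono)
        have "L * norm z \<le> \<bar>L\<bar> * norm z" by (intro mult_right_mono) auto
        also have "\<dots> \<le> \<bar>L\<bar> * \<bar>R\<bar>" using z by (intro mult_left_mono) auto
        finally show "L * norm z \<le> \<bar>L\<bar> * \<bar>R\<bar>" .
      qed simp
      finally show "norm (frechet_derivative m (at z) v) \<le> ?B * norm v"
        by (simp add: algebra_simps)
    qed
  qed (use that in auto)
  moreover have "?B \<ge> 0" using onorm_pos_le[OF bl] by simp
  ultimately show ?thesis by blast
qed

lemma divg_eq_trace: "divg m x = trace (matrix (frechet_derivative m (at x)))"
  by (simp add: divg_def trace_def matrix_def)

lemma has_derivative_grad: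
  fixes u :: "real^'n \<Rightarrow> real"
  assumes "u differentiable (at x)"
  shows "(u has_derivative (\<lambda>v. grad u x \<bullet> v)) (at x)"
proof -
  have d: "(u has_derivative frechet_derivative u (at x)) (at x)"
    using assms frechet_derivative_works by blast
  then interpret bounded_linear "frechet_derivative u (at x)"
    by (rule has_derivative_bounded_linear)
  have "frechet_derivative u (at x) v = grad u x \<bullet> v" for v
  proof -
    have "frechet_derivative u (at x) v = frechet_derivative u (at x) (\<Sum>i\<in>UNIV. v $ i *\<^sub>R axis i 1)"
      using basis_expansion[of v] by (simp add: scalar_mult_eq_scaleR)
    also have "\<dots> = (\<Sum>i\<in>UNIV. v $ i * frechet_derivative u (at x) (axis i 1))"
      by (simp add: sum scaleR)
    finally show ?thesis by (simp add: grad_def inner_vec_def mult.commute)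
  qed
  then have "frechet_derivative u (at x) = (\<lambda>v. grad u x \<bullet> v)" by blast
  then show ?thesis using d by simp
qed

definition hessian :: "(real^'n \<Rightarrow> real) \<Rightarrow> real^'n \<Rightarrow> real^'n^'n" where
  "hessian u x = matrix (frechet_derivative (grad u) (at x))"

lemma C2_grad_has_derivative:
  assumes "C2 u"
  shows "(grad u has_derivative (*v) (hessian u x)) (at x)"
proof -
  have "(grad u has_derivative frechet_derivative (grad u) (at x)) (at x)"
    using assms frechet_derivative_works by (auto simp: C2_def)
  moreover from this have "(*v) (hessian u x) = frechet_derivative (grad u) (at x)"
    unfolding hessian_def by (intro matrix_vector_mul(2) has_derivative_linear)
  ultimately show ?thesis by simp
qed

lemma C2_continuous_hessian:
  assumes "C2 u" shows "continuous_on UNIV (hessian u)"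
  using assms unfolding C2_def hessian_def matrix_def by (intro continuous_on_vec_lambda) auto

lemma C2_continuous_grad: "C2 u \<Longrightarrow> continuous_on S (grad u)"
  by (meson C2_grad_has_derivative continuous_at_imp_continuous_on has_derivative_continuous)

lemma C2_continuous: "C2 u \<Longrightarrow> continuous_on S u"
  unfolding C2_def by (meson continuous_at_imp_continuous_on differentiable_imp_continuous_within)

text \<open>A crude entrywise bound: each of the n^2 entries is at most
  \<open>norm A\<close>.\<close>

lemma abs_quadratic_form_le:
  fixes A :: "real^'n^'n"
  shows "\<bar>v \<bullet> (A *v v)\<bar> \<le> (real CARD('n))\<^sup>2 * norm A * (norm v)\<^sup>2"
proof -
  have "\<bar>v \<bullet> (A *v v)\<bar> = \<bar>\<Sum>i\<in>UNIV. \<Sum>j\<in>UNIV. v $ i * (A $ i $ j * v $ j)\<bar>"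
    by (simp add: inner_vec_def matrix_vector_mult_def sum_distrib_left)
  also have "\<dots> \<le> (\<Sum>i\<in>UNIV. \<Sum>j\<in>UNIV. \<bar>v $ i * (A $ i $ j * v $ j)\<bar>)"
    by (intro order_trans[OF sum_abs] sum_mono sum_abs)
  also have "\<dots> \<le> (\<Sum>i\<in>(UNIV::'n set). \<Sum>j\<in>(UNIV::'n set). norm v * (norm A * norm v))"
  proof (intro sum_mono)
    fix i j :: 'n
    have "\<bar>A $ i $ j\<bar> \<le> norm (A $ i)" by (rule component_le_norm_cart)
    also have "\<dots> \<le> norm A" by (rule Finite_Cartesian_Product.norm_nth_le)
    finally show "\<bar>v $ i * (A $ i $ j * v $ j)\<bar> \<le> norm v * (norm A * norm v)"
      unfolding abs_mult by (intro mult_mono component_le_norm_cart) auto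
  qed
  also have "\<dots> = (real CARD('n))\<^sup>2 * norm A * (norm v)\<^sup>2"
    by (simp add: power2_eq_square mult_ac)
  finally show ?thesis .
qed

text \<open>The one-variable formula along the segment from \<open>y\<close> to
  \<open>y + v\<close>: for \<open>k\<close> up to 2, \<open>\<phi> k\<close> is the k-th derivative
  of \<open>u\<close> along it.\<close>

lemma C2_taylor:
  assumes "C2 u"
  obtains t where "0 < t" "t < 1"
    "u (y + v) = u y + grad u y \<bullet> v + 1/2 * (v \<bullet> (hessian u (y + t *\<^sub>R v) *v v))"
proof -
  define \<phi> where "\<phi> k t = (if k = (0::nat) then u (y + t *\<^sub>R v) else if k = 1 then grad u (y + t *\<^sub>R v) \<bullet> v
     else v \<bullet> (hessian u (y + t *\<^sub>R v) *v v))" for k t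
  have line: "((\<lambda>t. y + t *\<^sub>R v) has_derivative (\<lambda>t. t *\<^sub>R v)) (at t)" for t
    by (auto intro!: derivative_eq_intros)
  have 0: "((\<lambda>t. u (y + t *\<^sub>R v)) has_real_derivative grad u (y + t *\<^sub>R v) \<bullet> v) (at t)" for t
  proof -
    have "u differentiable (at (y + t *\<^sub>R v))" using assms by (auto simp: C2_def)
    from diff_chain_at[OF line has_derivative_grad[OF this]]
    show ?thesis
      unfolding o_def by (rule has_derivative_imp_has_field_derivative) simp
  qed
  have 1: "((\<lambda>t. grad u (y + t *\<^sub>R v) \<bullet> v) has_real_derivative v \<bullet> (hessian u (y + t *\<^sub>R v) *v v)) (at t)" for t
  proof -
    have "((\<lambda>t. grad u (y + t *\<^sub>R v)) has_derivative (\<lambda>s. hessian u (y + t *\<^sub>R v) *v (s *\<^sub>R v))) (at t)"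
      using diff_chain_at[OF line C2_grad_has_derivative[OF assms]] by (simp add: o_def)
    from has_derivative_inner_left[OF this, of v]
    show ?thesis
      by (rule has_derivative_imp_has_field_derivative) (simp add: matrix_vector_mult_scaleR inner_commute)
  qed
  have "\<exists>t. 0 < t \<and> t < 1 \<and> \<phi> 0 1 = (\<Sum>k<2. \<phi> k 0 / fact k * 1 ^ k) + \<phi> 2 t / fact 2 * 1 ^ 2"
  proof (rule Maclaurin)
    show "\<forall>k t. k < 2 \<and> 0 \<le> t \<and> t \<le> 1 \<longrightarrow> (\<phi> k has_real_derivative \<phi> (Suc k) t) (at t)"
      using 0 1 by (auto simp: \<phi>_def[abs_def] less_2_cases_iff)
  qed auto
  then show thesis
    using that by (auto simp: \<phi>_def numeral_2_eq_2)
qed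

text \<open>
  The quartic term absorbs all large increments \<open>v\<close>, where the Taylor expansion says nothing; its Gaussian
  expectation is only \<open>O(h\<^sup>2)\<close>.
\<close>
lemma C2_taylor_upper:
  fixes u :: "real^'n \<Rightarrow> real"
  assumes u: "C2 u" and pos: "\<And>x. u x > 0" and e: "0 < e"
  obtains C where "C \<ge> 0" "\<And>y v. y \<in> cball 0 R \<Longrightarrow>
    indicator (cball 0 R) (y + v) * u (y + v) \<le>
      u y + grad u y \<bullet> v + 1/2 * (v \<bullet> (hessian u y *v v)) + e * (norm v)\<^sup>2 + C * norm v ^ 4"
proof -
  let ?n = "(real CARD('n))\<^sup>2"
  have n: "?n > 0" by simp
  \<comment> \<open>The intermediate point of the Taylor formula may leave \<open>cball 0 R\<close>,
    but by at most 1 since \<delta> \<le> 1. The threshold \<open>2 * e / ?n\<close> compensates the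
    factor in \<open>abs_quadratic_form_le\<close> and the 1/2 of the Taylor term.\<close>
  have "uniformly_continuous_on (cball 0 (R + 1)) (hessian u)"
    by (intro compact_uniformly_continuous continuous_on_subset[OF C2_continuous_hessian[OF u]]) auto
  then obtain d where d: "d > 0" "\<And>x z. x \<in> cball 0 (R + 1) \<Longrightarrow> z \<in> cball 0 (R + 1) \<Longrightarrow> dist z x < d
      \<Longrightarrow> dist (hessian u z) (hessian u x) < 2 * e / ?n"
    unfolding uniformly_continuous_on_def using e n by (metis divide_pos_pos mult_pos_pos zero_less_numeral)
  define \<delta> where "\<delta> = min d 1"
  have \<delta>: "\<delta> > 0" "\<delta> \<le> d" "\<delta> \<le> 1" using d by (auto simp: \<delta>_def)
  obtain M where M: "M > 0" "\<And>x. x \<in> cball 0 R \<Longrightarrow> norm (u x) \<le> M"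
    using continuous_bounded_cball[OF C2_continuous[OF u]] by metis
  obtain G where G: "G > 0" "\<And>x. x \<in> cball 0 R \<Longrightarrow> norm (grad u x) \<le> G"
    using continuous_bounded_cball[OF C2_continuous_grad[OF u]] by metis
  obtain H where H: "H > 0" "\<And>x. x \<in> cball 0 R \<Longrightarrow> norm (hessian u x) \<le> H"
    using continuous_bounded_cball[OF C2_continuous_hessian[OF u]] by metis
  \<comment> \<open>For \<open>norm v \<ge> \<delta>\<close> the three summands dominate in turn the
    killed value of \<open>u\<close>, minus the linear term and minus the quadratic term; the
    missing powers of \<open>norm v\<close> are paid for by powers of \<delta>.\<close>
  define C where "C = M / \<delta> ^ 4 + G / \<delta> ^ 3 + ?n * H / \<delta> ^ 2"
  have C: "C \<ge> 0" using M G H \<delta> by (simp add: C_def)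
  show thesis
  proof (rule that[OF C])
    fix y v :: "real^'n" assume y: "y \<in> cball 0 R"
    let ?Q = "u y + grad u y \<bullet> v + 1/2 * (v \<bullet> (hessian u y *v v))"
    show "indicator (cball 0 R) (y + v) * u (y + v) \<le> ?Q + e * (norm v)\<^sup>2 + C * norm v ^ 4"
    proof (cases "norm v < \<delta>")
      case True
      obtain t where t: "0 < t" "t < 1"
        "u (y + v) = u y + grad u y \<bullet> v + 1/2 * (v \<bullet> (hessian u (y + t *\<^sub>R v) *v v))"
        using C2_taylor[OF u] by metis
      have tv: "norm (t *\<^sub>R v) \<le> norm v" using t by (simp add: mult_left_le_one_le)
      have "dist (hessian u (y + t *\<^sub>R v)) (hessian u y) < 2 * e / ?n"
      proof (rule d(2))
        show "y + t *\<^sub>R v \<in> cball 0 (R + 1)"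
          using y tv True \<delta> norm_triangle_ineq[of y "t *\<^sub>R v"] by simp
      qed (use y tv True \<delta> in \<open>auto simp: dist_norm\<close>)
      then have "?n * norm (hessian u (y + t *\<^sub>R v) - hessian u y) \<le> 2 * e"
        using n by (simp add: dist_norm field_simps)
      then have "?n * norm (hessian u (y + t *\<^sub>R v) - hessian u y) * (norm v)\<^sup>2 \<le> 2 * e * (norm v)\<^sup>2"
        by (rule mult_right_mono) simp
      with abs_quadratic_form_le[of v "hessian u (y + t *\<^sub>R v) - hessian u y"]
      have "v \<bullet> (hessian u (y + t *\<^sub>R v) *v v) - v \<bullet> (hessian u y *v v) \<le> 2 * e * (norm v)\<^sup>2"
        by (simp add: matrix_vector_mult_diff_rdistrib inner_diff_right)
      then have "u (y + v) \<le> ?Q + e * (norm v)\<^sup>2" unfolding t(3) by simp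
      moreover have "indicator (cball 0 R) (y + v) * u (y + v) \<le> u (y + v)"
        using pos[of "y + v"] by (simp add: indicator_def)
      moreover have "0 \<le> C * norm v ^ 4" using C by simp
      ultimately show ?thesis by linarith
    next
      case False
      let ?r = "norm v"
      have r: "?r \<ge> \<delta>" "?r > 0" using False \<delta> by auto
      have "indicator (cball 0 R) (y + v) * u (y + v) \<le> M"
        using M(1) M(2)[of "y + v"] pos[of "y + v"] by (simp add: indicator_def)
      also have "M \<le> M / \<delta> ^ 4 * ?r ^ 4"
        using M power_mono[OF r(1), of 4] \<delta> by (simp add: field_simps)
      finally have 1: "indicator (cball 0 R) (y + v) * u (y + v) \<le> M / \<delta> ^ 4 * ?r ^ 4" .
      have "- (grad u y \<bullet> v) \<le> G * ?r"
        using Cauchy_Schwarz_ineq2[of "grad u y" v] mult_right_mono[OF G(2)[OF y], of ?r] by simp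
      also have "\<dots> \<le> G / \<delta> ^ 3 * ?r ^ 4"
      proof -
        have "G * ?r * \<delta> ^ 3 \<le> G * ?r * ?r ^ 3"
          using G r \<delta> by (intro mult_left_mono power_mono) auto
        then show ?thesis using \<delta> by (simp add: field_simps eval_nat_numeral)
      qed
      finally have 2: "- (grad u y \<bullet> v) \<le> G / \<delta> ^ 3 * ?r ^ 4" .
      have "- (1/2 * (v \<bullet> (hessian u y *v v))) \<le> \<bar>v \<bullet> (hessian u y *v v)\<bar>" by simp
      also have "\<dots> \<le> ?n * norm (hessian u y) * ?r\<^sup>2" by (rule abs_quadratic_form_le)
      also have "\<dots> \<le> ?n * H * ?r\<^sup>2" using H(2)[OF y] by (intro mult_right_mono mult_left_mono) auto
      also have "\<dots> \<le> ?n * H / \<delta> ^ 2 * ?r ^ 4"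
      proof -
        have "?n * H * ?r\<^sup>2 * \<delta> ^ 2 \<le> ?n * H * ?r\<^sup>2 * ?r ^ 2"
          using H r \<delta> by (intro mult_left_mono power_mono) auto
        then show ?thesis using \<delta> by (simp add: field_simps eval_nat_numeral)
      qed
      finally have 3: "- (1/2 * (v \<bullet> (hessian u y *v v))) \<le> ?n * H / \<delta> ^ 2 * ?r ^ 4" .
      have "0 \<le> e * ?r\<^sup>2" using e by simp
      moreover have "C * ?r ^ 4 = M / \<delta> ^ 4 * ?r ^ 4 + G / \<delta> ^ 3 * ?r ^ 4 + ?n * H / \<delta> ^ 2 * ?r ^ 4"
        by (simp add: C_def algebra_simps)
      ultimately show ?thesis using 1 2 3 pos[of y] by linarith
    qed
  qed
qed

text \<open>Since \<open>a\<close> is constant, the divergence of \<open>a *v grad u\<close> is the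
  trace of \<open>a\<close> times the Hessian. In this form the terms can be matched: the Taylor
  expansion of the mean produces the first two, the Jacobian produces the term with
  \<open>divg m\<close>.\<close>

lemma Lsharp_eq:
  assumes "C2 u"
  shows "Lsharp a m u x = 1/2 * (\<Sum>i\<in>UNIV. \<Sum>j\<in>UNIV. a $ i $ j * hessian u x $ j $ i) + m x \<bullet> grad u x + divg m x * u x"
proof -
  have "((\<lambda>y. a *v grad u y) has_derivative (\<lambda>v. a *v (hessian u x *v v))) (at x)"
    using C2_grad_has_derivative[OF assms, of x]
    by (rule bounded_linear.has_derivative[OF matrix_vector_mul_bounded_linear])
  then have "frechet_derivative (\<lambda>y. a *v grad u y) (at x) = (\<lambda>v. a *v (hessian u x *v v))"
    by (rule frechet_derivative_at[symmetric])
  then show ?thesis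
    by (simp add: Lsharp_def divg_def matrix_vector_mul_assoc matrix_vector_mult_basis column_def matrix_matrix_mult_def)
qed

section \<open>Expectation over one noise increment\<close>

text \<open>Retains of the Gaussian law with covariance \<open>h * a\<close> just the moments that
  the Taylor expansion meets; the fourth moment controls the quartic remainder. The bound
  \<open>\<kappa>\<close> is kept apart from \<open>h\<close> so that estimates are uniform in the
  step.\<close>

definition noise_law :: "real^'n^'n \<Rightarrow> real \<Rightarrow> real \<Rightarrow> (real^'n) measure \<Rightarrow> bool" where
  "noise_law a \<kappa> h \<nu> \<longleftrightarrow> prob_space \<nu> \<and> sets \<nu> = sets borel \<and>
     (\<forall>i. has_bochner_integral \<nu> (\<lambda>\<xi>. \<xi> $ i) 0) \<and>
     (\<forall>i j. has_bochner_integral \<nu> (\<lambda>\<xi>. \<xi> $ i * \<xi> $ j) (h * a $ i $ j)) \<and>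
     integrable \<nu> (\<lambda>\<xi>. norm \<xi> ^ 4) \<and> (\<integral>\<xi>. norm \<xi> ^ 4 \<partial>\<nu>) \<le> \<kappa> * h\<^sup>2"

lemma noise_law_integral_quartic:
  assumes "noise_law a \<kappa> h \<nu>"
  shows "has_bochner_integral \<nu> (\<lambda>\<xi>. c + l \<bullet> \<xi> + \<xi> \<bullet> (Q *v \<xi>) + D * norm \<xi> ^ 4)
    (c + h * (\<Sum>i\<in>UNIV. \<Sum>j\<in>UNIV. a $ i $ j * Q $ j $ i) + D * (\<integral>\<xi>. norm \<xi> ^ 4 \<partial>\<nu>))"
proof -
  interpret prob_space \<nu> using assms by (simp add: noise_law_def)
  have 0: "has_bochner_integral \<nu> (\<lambda>\<xi>. c) c"
    by (simp add: has_bochner_integral_iff prob_space)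
  have "has_bochner_integral \<nu> (\<lambda>\<xi>. \<Sum>i\<in>UNIV. l $ i * \<xi> $ i) (\<Sum>i\<in>UNIV. l $ i * 0)"
    using assms by (intro has_bochner_integral_sum has_bochner_integral_mult_right) (auto simp: noise_law_def)
  then have 1: "has_bochner_integral \<nu> (\<lambda>\<xi>. l \<bullet> \<xi>) 0"
    by (simp add: inner_vec_def)
  have "has_bochner_integral \<nu> (\<lambda>\<xi>. \<Sum>i\<in>UNIV. \<Sum>j\<in>UNIV. Q $ j $ i * (\<xi> $ i * \<xi> $ j))
      (\<Sum>i\<in>UNIV. \<Sum>j\<in>UNIV. Q $ j $ i * (h * a $ i $ j))"
    using assms by (intro has_bochner_integral_sum has_bochner_integral_mult_right) (auto simp: noise_law_def)
  moreover have "(\<Sum>i\<in>UNIV. \<Sum>j\<in>UNIV. Q $ j $ i * (\<xi> $ i * \<xi> $ j)) = \<xi> \<bullet> (Q *v \<xi>)" for \<xi>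
    by (subst sum.swap) (simp add: inner_vec_def matrix_vector_mult_def sum_distrib_left mult_ac)
  ultimately have 2: "has_bochner_integral \<nu> (\<lambda>\<xi>. \<xi> \<bullet> (Q *v \<xi>)) (h * (\<Sum>i\<in>UNIV. \<Sum>j\<in>UNIV. a $ i $ j * Q $ j $ i))"
    by (simp add: sum_distrib_left mult_ac)
  have 3: "has_bochner_integral \<nu> (\<lambda>\<xi>. D * norm \<xi> ^ 4) (D * (\<integral>\<xi>. norm \<xi> ^ 4 \<partial>\<nu>))"
    using assms by (intro has_bochner_integral_mult_right) (auto simp: noise_law_def has_bochner_integral_iff)
  show ?thesis
    using has_bochner_integral_add[OF has_bochner_integral_add[OF has_bochner_integral_add[OF 0 1] 2] 3] by simp
qed

text \<open>Inserting \<open>v = h *\<^sub>R m y + \<xi>\<close> into \<open>C2_taylor_upper\<close>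
  and splitting the powers of its norm bounds the killed integrand by a polynomial in \<xi>. Its
  mean depends only on the moments in \<open>noise_law\<close>, so the constant is uniform in
  \<open>y\<close>, \<open>h\<close> and the law.\<close>

lemma expected_value_taylor_upper:
  fixes u :: "real^'n \<Rightarrow> real"
  assumes m: "C11 m" and u: "C2 u" and pos: "\<And>x. u x > 0" and e: "0 < e" and \<kappa>: "0 \<le> \<kappa>"
  obtains C where "C \<ge> 0" "\<And>h \<nu> y. 0 < h \<Longrightarrow> h \<le> 1 \<Longrightarrow> noise_law a \<kappa> h \<nu> \<Longrightarrow> y \<in> cball 0 R \<Longrightarrow>
    (\<integral>\<xi>. indicator (cball 0 R) (y + h *\<^sub>R m y + \<xi>) * u (y + h *\<^sub>R m y + \<xi>) \<partial>\<nu>)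
      \<le> u y + h * (m y \<bullet> grad u y + 1/2 * (\<Sum>i\<in>UNIV. \<Sum>j\<in>UNIV. a $ i $ j * hessian u y $ j $ i))
         + h * e + C * h\<^sup>2"
proof -
  \<comment> \<open>The term \<open>e' * (norm v)\<^sup>2\<close> contributes
    \<open>2 * e' * h * trace a\<close> to the mean, which has to stay below \<open>h * e\<close>;
    the added 1 avoids division by 0.\<close>
  define e' where "e' = e / (2 * (\<bar>trace a\<bar> + 1))"
  have e': "e' > 0" using e by (simp add: e'_def)
  have e'_le: "2 * e' * trace a \<le> e"
  proof -
    have "2 * e' * trace a \<le> 2 * e' * (\<bar>trace a\<bar> + 1)" using e' by (intro mult_left_mono) auto
    also have "\<dots> = e" unfolding e'_def by (simp add: divide_simps)
    finally show ?thesis .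
  qed
  obtain C where C: "C \<ge> 0" "\<And>y v. y \<in> cball 0 R \<Longrightarrow>
    indicator (cball 0 R) (y + v) * u (y + v) \<le>
      u y + grad u y \<bullet> v + 1/2 * (v \<bullet> (hessian u y *v v)) + e' * (norm v)\<^sup>2 + C * norm v ^ 4"
    using C2_taylor_upper[OF u pos e'] by metis
  obtain b where b: "b > 0" "\<And>x. x \<in> cball 0 R \<Longrightarrow> norm (m x) \<le> b"
    using continuous_bounded_cball[OF C11_continuous[OF m]] by metis
  obtain H where H: "H > 0" "\<And>x. x \<in> cball 0 R \<Longrightarrow> norm (hessian u x) \<le> H"
    using continuous_bounded_cball[OF C2_continuous_hessian[OF u]] by metis
  obtain M where M: "M > 0" "\<And>x. x \<in> cball 0 R \<Longrightarrow> norm (u x) \<le> M"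
    using continuous_bounded_cball[OF C2_continuous[OF u]] by metis
  \<comment> \<open>In order: the quadratic term at the drift displacement, the drift part of the
    \<open>e'\<close> term, and the drift and noise parts of the quartic term. Each is O(h^2) for h
    \<le> 1.\<close>
  define K where "K = (real CARD('n))\<^sup>2 * H * b\<^sup>2 + 2 * e' * b\<^sup>2 + 8 * C * b ^ 4 + 8 * C * \<kappa>"
  have K: "K \<ge> 0" using C(1) H b e' \<kappa> by (simp add: K_def)
  show thesis
  proof (rule that[OF K])
    fix h \<nu> and y :: "real^'n"
    assume h: "0 < h" "h \<le> 1" and \<nu>: "noise_law a \<kappa> h \<nu>" and y: "y \<in> cball 0 R"
    interpret prob_space \<nu> using \<nu> by (simp add: noise_law_def)
    have [measurable_cong]: "sets \<nu> = sets borel" using \<nu> by (simp add: noise_law_def)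
    have [measurable]: "u \<in> borel_measurable borel"
      using C2_continuous[OF u] by (rule borel_measurable_continuous_onI)
    let ?m = "m y" and ?g = "grad u y" and ?H = "hessian u y"
    let ?F = "\<lambda>\<xi>. indicator (cball 0 R) (y + h *\<^sub>R ?m + \<xi>) * u (y + h *\<^sub>R ?m + \<xi>)"
    \<comment> \<open>Coefficients of the majorant sorted by degree in \<xi>. \<open>l\<close>
      carries both mixed terms of the Hessian form, hence the transpose; the factors 2 and 8 come
      from bounding the square and the fourth power of a sum.\<close>
    define Q where "Q = (1/2) *\<^sub>R ?H + (2 * e') *\<^sub>R mat 1"
    define l where "l = ?g + (h / 2) *\<^sub>R (?H *v ?m + transpose ?H *v ?m)"
    define c where "c = u y + h * (?m \<bullet> ?g) + h\<^sup>2 * (1/2 * (?m \<bullet> (?H *v ?m)) + 2 * e' * (norm ?m)\<^sup>2) + 8 * C * (h ^ 4 * norm ?m ^ 4)"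
    let ?f = "\<lambda>\<xi>. c + l \<bullet> \<xi> + \<xi> \<bullet> (Q *v \<xi>) + 8 * C * norm \<xi> ^ 4"
    have le: "?F \<xi> \<le> ?f \<xi>" for \<xi>
    proof -
      let ?v = "h *\<^sub>R ?m + \<xi>"
      have quad: "?v \<bullet> (?H *v ?v) = h\<^sup>2 * (?m \<bullet> (?H *v ?m)) + h * ((?H *v ?m + transpose ?H *v ?m) \<bullet> \<xi>) + \<xi> \<bullet> (?H *v \<xi>)"
      proof -
        have "(transpose ?H *v ?m) \<bullet> \<xi> = ?m \<bullet> (?H *v \<xi>)"
          by (simp add: dot_lmul_matrix)
        moreover have "(?H *v ?m) \<bullet> \<xi> = \<xi> \<bullet> (?H *v ?m)"
          by (rule inner_commute)
        ultimately show ?thesis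
          by (simp only: matrix_vector_right_distrib matrix_vector_mult_scaleR inner_add_left inner_add_right
            inner_scaleR_left inner_scaleR_right) (simp add: power2_eq_square algebra_simps)
      qed
      have "norm ?v \<le> h * norm ?m + norm \<xi>"
        using norm_triangle_ineq[of "h *\<^sub>R ?m" \<xi>] h by simp
      then have "(norm ?v)\<^sup>2 \<le> (h * norm ?m + norm \<xi>)\<^sup>2" by (intro power_mono) auto
      also have "\<dots> \<le> 2 * (h\<^sup>2 * (norm ?m)\<^sup>2) + 2 * (norm \<xi>)\<^sup>2"
        using sum_squares_bound[of "h * norm ?m" "norm \<xi>"] by (simp add: power2_sum power_mult_distrib)
      finally have sq: "(norm ?v)\<^sup>2 \<le> 2 * (h\<^sup>2 * (norm ?m)\<^sup>2) + 2 * (norm \<xi>)\<^sup>2" .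
      then have "((norm ?v)\<^sup>2)\<^sup>2 \<le> (2 * (h\<^sup>2 * (norm ?m)\<^sup>2) + 2 * (norm \<xi>)\<^sup>2)\<^sup>2" by (intro power_mono) auto
      also have "\<dots> \<le> 8 * (h\<^sup>2 * (norm ?m)\<^sup>2)\<^sup>2 + 8 * ((norm \<xi>)\<^sup>2)\<^sup>2"
        using sum_squares_bound[of "2 * (h\<^sup>2 * (norm ?m)\<^sup>2)" "2 * (norm \<xi>)\<^sup>2"] by (simp add: power2_sum power_mult_distrib)
      finally have qu: "norm ?v ^ 4 \<le> 8 * (h ^ 4 * norm ?m ^ 4) + 8 * norm \<xi> ^ 4"
        by (simp add: power_mult_distrib flip: power_mult)
      have "?F \<xi> \<le> u y + ?g \<bullet> ?v + 1/2 * (?v \<bullet> (?H *v ?v)) + e' * (norm ?v)\<^sup>2 + C * norm ?v ^ 4"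
        using C(2)[OF y, of ?v] by (simp add: add.assoc)
      also have "\<dots> \<le> u y + ?g \<bullet> ?v + 1/2 * (?v \<bullet> (?H *v ?v)) + e' * (2 * (h\<^sup>2 * (norm ?m)\<^sup>2) + 2 * (norm \<xi>)\<^sup>2)
          + C * (8 * (h ^ 4 * norm ?m ^ 4) + 8 * norm \<xi> ^ 4)"
        using sq qu e' C(1) by (intro add_mono mult_left_mono order_refl) auto
      also have "\<dots> = ?f \<xi>"
        unfolding quad c_def l_def Q_def
        by (simp add: matrix_vector_mult_add_rdistrib scaleR_matrix_vector_assoc[symmetric] inner_add_left inner_add_right
            power2_norm_eq_inner inner_commute algebra_simps)
      finally show ?thesis .
    qed
    have F_bd: "norm (?F \<xi>) \<le> M" for \<xi>
      using M(1) M(2)[of "y + h *\<^sub>R ?m + \<xi>"] by (simp add: indicator_def)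
    have [measurable]: "cball (0::real^'n) R \<in> sets borel" by simp
    have "?F \<in> borel_measurable \<nu>" by measurable
    then have intF: "integrable \<nu> ?F"
      using F_bd by (intro integrable_const_bound[where B = M]) auto
    note f = noise_law_integral_quartic[OF \<nu>, of c l Q "8 * C"]
    have "(\<integral>\<xi>. ?F \<xi> \<partial>\<nu>) \<le> (\<integral>\<xi>. ?f \<xi> \<partial>\<nu>)"
      using intF f le by (intro integral_mono) (auto simp: has_bochner_integral_iff)
    also have "\<dots> = c + h * (\<Sum>i\<in>UNIV. \<Sum>j\<in>UNIV. a $ i $ j * Q $ j $ i) + 8 * C * (\<integral>\<xi>. norm \<xi> ^ 4 \<partial>\<nu>)"
      using f by (simp add: has_bochner_integral_iff)
    also have "\<dots> \<le> c + h * (\<Sum>i\<in>UNIV. \<Sum>j\<in>UNIV. a $ i $ j * Q $ j $ i) + 8 * C * (\<kappa> * h\<^sup>2)"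
      using \<nu> C(1) by (intro add_left_mono mult_left_mono) (auto simp: noise_law_def)
    also have "(\<Sum>i\<in>UNIV. \<Sum>j\<in>UNIV. a $ i $ j * Q $ j $ i) =
        1/2 * (\<Sum>i\<in>UNIV. \<Sum>j\<in>UNIV. a $ i $ j * ?H $ j $ i) + 2 * e' * trace a"
    proof -
      have "a $ i $ j * Q $ j $ i = 1/2 * (a $ i $ j * ?H $ j $ i) + (if j = i then 2 * e' * a $ i $ i else 0)" for i j
        by (auto simp: Q_def mat_def algebra_simps)
      then show ?thesis by (simp add: sum.distrib trace_def sum_distrib_left)
    qed
    finally have E: "(\<integral>\<xi>. ?F \<xi> \<partial>\<nu>) \<le> c + h * (1/2 * (\<Sum>i\<in>UNIV. \<Sum>j\<in>UNIV. a $ i $ j * ?H $ j $ i) + 2 * e' * trace a) + 8 * C * (\<kappa> * h\<^sup>2)" .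
    have nm: "norm ?m \<le> b" by (rule b(2)[OF y])
    have "1/2 * (?m \<bullet> (?H *v ?m)) \<le> \<bar>?m \<bullet> (?H *v ?m)\<bar>" by simp
    also have "\<dots> \<le> (real CARD('n))\<^sup>2 * norm ?H * (norm ?m)\<^sup>2" by (rule abs_quadratic_form_le)
    also have "\<dots> \<le> (real CARD('n))\<^sup>2 * H * b\<^sup>2"
      using H(2)[OF y] H(1) nm by (intro mult_mono power_mono) auto
    finally have 1: "h\<^sup>2 * (1/2 * (?m \<bullet> (?H *v ?m))) \<le> h\<^sup>2 * ((real CARD('n))\<^sup>2 * H * b\<^sup>2)"
      by (intro mult_left_mono) auto
    have 2: "h\<^sup>2 * (2 * e' * (norm ?m)\<^sup>2) \<le> h\<^sup>2 * (2 * e' * b\<^sup>2)"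
      using nm e' by (intro mult_left_mono power_mono) auto
    have 3: "8 * C * (h ^ 4 * norm ?m ^ 4) \<le> 8 * C * (h\<^sup>2 * b ^ 4)"
      using nm C(1) h by (intro mult_left_mono mult_mono power_mono power_decreasing) auto
    have 4: "h * (2 * e' * trace a) \<le> h * e"
      using e'_le h by (intro mult_left_mono) auto
    show "(\<integral>\<xi>. ?F \<xi> \<partial>\<nu>) \<le> u y + h * (?m \<bullet> ?g + 1/2 * (\<Sum>i\<in>UNIV. \<Sum>j\<in>UNIV. a $ i $ j * ?H $ j $ i))
         + h * e + K * h\<^sup>2"
      using E 1 2 3 4 unfolding c_def K_def by (simp add: algebra_simps)
  qed
qed

text \<open>To be read with \<open>d\<close> the divergence of the drift, \<open>g\<close> the first
  and second order part of \<open>Lsharp\<close>, and \<open>u\<close> the value, all at one point: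
  the first order coefficient \<open>g + d * u\<close> of the product is then the full operator, and
  everything else is of order \<open>h\<^sup>2\<close> or the tolerance \<open>e\<close>.\<close>

lemma one_step_product_bound:
  fixes h :: real
  assumes h: "0 < h" "h \<le> 1" and J: "0 \<le> J" "J \<le> 1 + h * d + K1 * h\<^sup>2" and E: "0 \<le> E" "E \<le> u + h * g + h * e + K2 * h\<^sup>2"
    and b: "\<bar>d\<bar> \<le> b" "\<bar>g\<bar> \<le> b" "\<bar>u\<bar> \<le> b" and nonneg: "0 \<le> K1" "0 \<le> K2" "0 \<le> e"
  shows "J * E \<le> u + h * (g + d * u) + h * e + (K2 + K1 * b + (b + K1) * (b + e + K2)) * h\<^sup>2"
proof -
  have "J * E \<le> (1 + h * d + K1 * h\<^sup>2) * (u + h * g + h * e + K2 * h\<^sup>2)"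
    using J E by (intro mult_mono) auto
  also have "\<dots> = u + h * (g + d * u) + h * e + (K2 + K1 * u + (d + K1 * h) * (g + e + K2 * h)) * h\<^sup>2"
    by (simp add: algebra_simps power2_eq_square)
  also have "\<dots> \<le> u + h * (g + d * u) + h * e + (K2 + K1 * b + (b + K1) * (b + e + K2)) * h\<^sup>2"
  proof (rule add_left_mono, rule mult_right_mono, intro add_mono order_refl mult_left_mono)
    have "K1 * h \<le> K1" "K2 * h \<le> K2" "0 \<le> K1 * h" "0 \<le> K2 * h" using h nonneg by (auto simp: mult_left_le)
    then have 1: "\<bar>d + K1 * h\<bar> \<le> b + K1" "\<bar>g + e + K2 * h\<bar> \<le> b + e + K2"
      using b nonneg by linarith+
    have "(d + K1 * h) * (g + e + K2 * h) \<le> \<bar>d + K1 * h\<bar> * \<bar>g + e + K2 * h\<bar>"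
      by (simp flip: abs_mult)
    also have "\<dots> \<le> (b + K1) * (b + e + K2)"
      using 1 b nonneg by (intro mult_mono) auto
    finally show "(d + K1 * h) * (g + e + K2 * h) \<le> (b + K1) * (b + e + K2)" .
  qed (use b nonneg in auto)
  finally show ?thesis .
qed

text \<open>The product of Jacobian and killed mean is \<open>u y + h * Lsharp a m u y\<close> up to
  additive errors. On the ball \<open>u\<close> is at least some \<open>c > 0\<close>, so these
  errors can be absorbed as \<open>e * h * u y\<close>.\<close>

lemma one_step_supermartingale:
  fixes u :: "real^'n \<Rightarrow> real"
  assumes m: "C11 m" and u: "C2 u" and pos: "\<And>x. u x > 0" and e: "0 < e" and \<kappa>: "0 \<le> \<kappa>"
    and super: "\<And>x. Lsharp a m u x \<le> - \<mu> * u x"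
  obtains h0 where "h0 > 0" "\<And>h \<nu> y. 0 < h \<Longrightarrow> h \<le> h0 \<Longrightarrow> noise_law a \<kappa> h \<nu> \<Longrightarrow> y \<in> cball 0 R \<Longrightarrow>
    \<bar>det (mat 1 + h *\<^sub>R matrix (frechet_derivative m (at y)))\<bar> *
    (\<integral>\<xi>. indicator (cball 0 R) (y + h *\<^sub>R m y + \<xi>) * u (y + h *\<^sub>R m y + \<xi>) \<partial>\<nu>)
      \<le> (1 + (e - \<mu>) * h) * u y"
proof -
  let ?D = "\<lambda>y. matrix (frechet_derivative m (at y))"
  let ?g = "\<lambda>y. m y \<bullet> grad u y + 1/2 * (\<Sum>i\<in>UNIV. \<Sum>j\<in>UNIV. a $ i $ j * hessian u y $ j $ i)"
  have contu: "continuous_on UNIV u" by (rule C2_continuous[OF u])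
  have "continuous_on UNIV (\<lambda>x. inverse (u x))"
    using pos by (intro continuous_on_inverse contu ballI) (metis less_irrefl)
  then obtain c' where c': "c' > 0" "\<And>x. x \<in> cball 0 R \<Longrightarrow> norm (inverse (u x)) \<le> c'"
    by (rule continuous_bounded_cball[where R = R]) blast
  define c where "c = inverse c'"
  have c: "c > 0" "\<And>x. x \<in> cball 0 R \<Longrightarrow> c \<le> u x"
  proof -
    show "c > 0" using c' by (simp add: c_def)
    fix x :: "real^'n" assume "x \<in> cball 0 R"
    then have "inverse (u x) \<le> c'" using c'(2)[of x] pos[of x] by simp
    then show "c \<le> u x" unfolding c_def using pos[of x] c'(1) by (simp add: field_simps)
  qed
  \<comment> \<open>One half of \<open>e * c\<close> is for the Taylor tolerance, the other half for
    the terms of order \<open>h\<^sup>2\<close>.\<close>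
  define e' where "e' = e * c / 2"
  have e': "e' > 0" using e c by (simp add: e'_def)
  obtain K2 where K2: "K2 \<ge> 0" "\<And>h \<nu> y. 0 < h \<Longrightarrow> h \<le> 1 \<Longrightarrow> noise_law a \<kappa> h \<nu> \<Longrightarrow> y \<in> cball 0 R \<Longrightarrow>
    (\<integral>\<xi>. indicator (cball 0 R) (y + h *\<^sub>R m y + \<xi>) * u (y + h *\<^sub>R m y + \<xi>) \<partial>\<nu>)
      \<le> u y + h * ?g y + h * e' + K2 * h\<^sup>2"
    by (rule expected_value_taylor_upper[OF m u pos e' \<kappa>, of a R]) (rule that)
  obtain K where K: "K > 0" "\<And>x. x \<in> cball 0 R \<Longrightarrow> norm (?D x) \<le> K"
    using continuous_bounded_cball[OF C11_continuous_jacobian[OF m]] by metis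
  obtain K1 where K1: "K1 \<ge> 0" "\<And>(B::real^'n^'n) h. (\<forall>i j. \<bar>B $ i $ j\<bar> \<le> K) \<Longrightarrow> 0 \<le> h \<Longrightarrow> h \<le> 1 \<Longrightarrow>
    \<bar>det (mat 1 + h *\<^sub>R B) - (1 + h * trace B)\<bar> \<le> K1 * h\<^sup>2"
    using det_near_identity[OF less_imp_le[OF K(1)], where ?'n = 'n] by blast
  have "continuous_on UNIV (\<lambda>y. (divg m y, ?g y, u y))"
    unfolding divg_eq_trace trace_def
    by (intro continuous_intros contu C11_continuous[OF m] C2_continuous_grad[OF u]
        C2_continuous_hessian[OF u] C11_continuous_jacobian[OF m])
  then obtain b where b: "b > 0" "\<And>x. x \<in> cball 0 R \<Longrightarrow> norm (divg m x, ?g x, u x) \<le> b"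
    by (rule continuous_bounded_cball[where R = R]) blast
  have bd: "\<bar>divg m x\<bar> \<le> b" "\<bar>?g x\<bar> \<le> b" "\<bar>u x\<bar> \<le> b" if "x \<in> cball 0 R" for x
  proof -
    have "\<bar>divg m x\<bar> \<le> norm (divg m x, ?g x, u x)" using norm_fst_le[of "divg m x"] by simp
    then show "\<bar>divg m x\<bar> \<le> b" using b(2)[OF that] by linarith
    have 2: "norm (?g x, u x) \<le> norm (divg m x, ?g x, u x)" by (rule norm_snd_le)
    have "\<bar>?g x\<bar> \<le> norm (?g x, u x)" using norm_fst_le[of "?g x"] by simp
    then show "\<bar>?g x\<bar> \<le> b" using b(2)[OF that] 2 by linarith
    have "\<bar>u x\<bar> \<le> norm (?g x, u x)" using norm_snd_le[of "u x"] by simp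
    then show "\<bar>u x\<bar> \<le> b" using b(2)[OF that] 2 by linarith
  qed
  define K3 where "K3 = K2 + K1 * b + (b + K1) * (b + e' + K2)"
  have K3: "K3 > 0" using K1 K2 b e' by (simp add: K3_def add_nonneg_pos)
  \<comment> \<open>\<open>1 / b\<close> keeps \<open>1 + h * divg m y\<close> nonnegative, so that
    it survives the absolute value of the determinant; \<open>e' / K3\<close> makes
    \<open>K3 * h\<^sup>2\<close> at most \<open>h * e'\<close>.\<close>
  define h0 where "h0 = min (min 1 (1 / b)) (e' / K3)"
  have h0: "h0 > 0" "h0 \<le> 1" "h0 * b \<le> 1" "K3 * h0 \<le> e'"
  proof -
    have "h0 \<le> 1 / b" "h0 \<le> e' / K3" by (auto simp: h0_def)
    then show "h0 * b \<le> 1" "K3 * h0 \<le> e'"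
      using b(1) K3 by (simp_all add: pos_le_divide_eq mult.commute)
    show "h0 > 0" "h0 \<le> 1" using b(1) K3 e' by (simp_all add: h0_def)
  qed
  show thesis
  proof (rule that[OF h0(1)])
    fix h \<nu> and y :: "real^'n"
    assume h: "0 < h" "h \<le> h0" and \<nu>: "noise_law a \<kappa> h \<nu>" and y: "y \<in> cball 0 R"
    let ?J = "\<bar>det (mat 1 + h *\<^sub>R ?D y)\<bar>"
    let ?E = "\<integral>\<xi>. indicator (cball 0 R) (y + h *\<^sub>R m y + \<xi>) * u (y + h *\<^sub>R m y + \<xi>) \<partial>\<nu>"
    have h1: "h \<le> 1" using h h0 by simp
    have "\<bar>?D y $ i $ j\<bar> \<le> K" for i j
    proof -
      have "\<bar>?D y $ i $ j\<bar> \<le> norm (?D y $ i)" by (rule component_le_norm_cart)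
      also have "\<dots> \<le> norm (?D y)" by (rule Finite_Cartesian_Product.norm_nth_le)
      finally show ?thesis using K(2)[OF y] by linarith
    qed
    then have det: "\<bar>det (mat 1 + h *\<^sub>R ?D y) - (1 + h * divg m y)\<bar> \<le> K1 * h\<^sup>2"
      using K1(2)[of "?D y" h] h h1 by (simp add: divg_eq_trace)
    have "\<bar>h * divg m y\<bar> \<le> h0 * b"
      unfolding abs_mult using h bd(1)[OF y] by (intro mult_mono) auto
    then have "0 \<le> 1 + h * divg m y" using h0 by linarith
    then have J: "?J \<le> 1 + h * divg m y + K1 * h\<^sup>2" using det by linarith
    have E0: "0 \<le> ?E" using pos by (intro Bochner_Integration.integral_nonneg) (auto simp: less_imp_le)
    have "?J * ?E \<le> u y + h * (?g y + divg m y * u y) + h * e' + K3 * h\<^sup>2"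
      unfolding K3_def
      by (rule one_step_product_bound[OF h(1) h1 _ J E0 K2(2)[OF h(1) h1 \<nu> y] bd[OF y] K1(1) K2(1)])
        (use e' in auto)
    also have "?g y + divg m y * u y = Lsharp a m u y"
      by (simp add: Lsharp_eq[OF u])
    also have "u y + h * Lsharp a m u y + h * e' + K3 * h\<^sup>2 \<le> u y + h * (- \<mu> * u y) + h * e' + h * e'"
    proof (intro add_mono mult_left_mono order_refl super)
      have "K3 * h\<^sup>2 = (K3 * h) * h" by (simp add: power2_eq_square)
      also have "\<dots> \<le> (K3 * h0) * h" using h K3 by (intro mult_right_mono mult_left_mono) auto
      also have "\<dots> \<le> e' * h" using h h0 by (intro mult_right_mono) auto
      finally show "K3 * h\<^sup>2 \<le> h * e'" by (simp add: mult.commute)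
    qed (use h in auto)
    also have "\<dots> = u y + h * (- \<mu> * u y) + h * (e * c)" by (simp add: e'_def)
    also have "\<dots> \<le> u y + h * (- \<mu> * u y) + h * (e * u y)"
      using c(2)[OF y] h e by (intro add_left_mono mult_left_mono) auto
    also have "\<dots> = (1 + (e - \<mu>) * h) * u y" by (simp add: algebra_simps)
    finally show "?J * ?E \<le> (1 + (e - \<mu>) * h) * u y" .
  qed
qed

section \<open>Maximal inequality for the Euler scheme\<close>

text \<open>Doob's maximal inequality for a nonnegative supermartingale in product coordinates:
  conditioning on the first \<open>K\<close> coordinates means integrating out coordinate
  \<open>K\<close>, so by Fubini the mean of the stopped process does not increase. The value at
  \<open>\<lambda>_. undefined\<close> is that at the only point of the empty product.\<close>

lemma maximal_inequality_PiM:
  fixes \<nu> :: "nat \<Rightarrow> 'a measure" and F :: "nat \<Rightarrow> (nat \<Rightarrow> 'a) \<Rightarrow> ennreal"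
  assumes \<nu>: "\<And>i. prob_space (\<nu> i)"
    and meas: "\<And>k K. k \<le> K \<Longrightarrow> F k \<in> borel_measurable (PiM {..<K} \<nu>)"
    and local: "\<And>k j w y. j \<ge> k \<Longrightarrow> F k (w(j := y)) = F k w"
    and step: "\<And>k w. w \<in> space (PiM {..<k} \<nu>) \<Longrightarrow> (\<integral>\<^sup>+y. F (Suc k) (w(k := y)) \<partial>\<nu> k) \<le> F k w"
  shows "c * emeasure (PiM {..<K} \<nu>) {w \<in> space (PiM {..<K} \<nu>). \<exists>k\<le>K. c \<le> F k w} \<le> F 0 (\<lambda>_. undefined)"
proof -
  interpret prob_space "\<nu> i" for i by (rule \<nu>)
  interpret product_sigma_finite \<nu> ..
  let ?P = "\<lambda>K. PiM {..<K} \<nu>"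
  \<comment> \<open>\<open>G\<close> is \<open>F\<close> stopped at the first passage above \<open>c\<close> and truncated there to \<open>c\<close>.\<close>
  define G where "G K w = (if \<exists>k\<le>K. c \<le> F k w then c else F K w)" for K w
  have [measurable]: "F k \<in> borel_measurable (?P K)" if "k \<le> K" for k K
    using meas that .
  have ev [measurable]: "Measurable.pred (?P K) (\<lambda>w. \<exists>k\<le>K. c \<le> F k w)" for K
  proof -
    have "Measurable.pred (?P K) (\<lambda>w. \<exists>k\<in>{..K}. c \<le> F k w)"
    proof (intro pred_intros_finite)
      fix k assume "k \<in> {..K}"
      then show "Measurable.pred (?P K) (\<lambda>w. c \<le> F k w)" by simp
    qed simp
    then show ?thesis by (simp add: Bex_def)
  qed
  have [measurable]: "G K \<in> borel_measurable (?P K)" for K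
    unfolding G_def by measurable
  have "(\<integral>\<^sup>+w. G K w \<partial>?P K) \<le> F 0 (\<lambda>_. undefined)" for K
  proof (induction K)
    case 0
    show ?case by (auto simp: PiM_empty nn_integral_count_space_finite G_def)
  next
    case (Suc K)
    have eq: "{..<Suc K} = insert K {..<K}" by auto
    have "(\<integral>\<^sup>+w. G (Suc K) w \<partial>?P (Suc K)) = (\<integral>\<^sup>+w. (\<integral>\<^sup>+y. G (Suc K) (w(K := y)) \<partial>\<nu> K) \<partial>?P K)"
      unfolding eq by (rule product_nn_integral_insert) (auto simp flip: eq)
    also have "\<dots> \<le> (\<integral>\<^sup>+w. G K w \<partial>?P K)"
    proof (rule nn_integral_mono)
      fix w assume w: "w \<in> space (?P K)"
      show "(\<integral>\<^sup>+y. G (Suc K) (w(K := y)) \<partial>\<nu> K) \<le> G K w"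
      proof (cases "\<exists>k\<le>K. c \<le> F k w")
        case True
        then have "G (Suc K) (w(K := y)) = c" for y
          unfolding G_def using local by (metis le_SucI)
        then show ?thesis using True by (simp add: G_def emeasure_space_1)
      next
        case False
        have "(\<integral>\<^sup>+y. G (Suc K) (w(K := y)) \<partial>\<nu> K) \<le> (\<integral>\<^sup>+y. F (Suc K) (w(K := y)) \<partial>\<nu> K)"
        proof (rule nn_integral_mono)
          fix y
          have "\<not> (\<exists>k\<le>K. c \<le> F k (w(K := y)))" using False local by metis
          then show "G (Suc K) (w(K := y)) \<le> F (Suc K) (w(K := y))"
            unfolding G_def by (auto simp: le_Suc_eq)
        qed
        also have "\<dots> \<le> F K w" by (rule step[OF w])
        also have "F K w = G K w" using False by (auto simp: G_def)
        finally show ?thesis .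
      qed
    qed
    also have "\<dots> \<le> F 0 (\<lambda>_. undefined)" by (rule Suc.IH)
    finally show ?case .
  qed
  moreover have "c * emeasure (?P K) {w \<in> space (?P K). \<exists>k\<le>K. c \<le> F k w} \<le> (\<integral>\<^sup>+w. G K w \<partial>?P K)"
  proof -
    have "c * emeasure (?P K) {w \<in> space (?P K). \<exists>k\<le>K. c \<le> F k w}
        = (\<integral>\<^sup>+w. c * indicator {w \<in> space (?P K). \<exists>k\<le>K. c \<le> F k w} w \<partial>?P K)"
      by (subst nn_integral_cmult_indicator) auto
    also have "\<dots> \<le> (\<integral>\<^sup>+w. G K w \<partial>?P K)"
      by (rule nn_integral_mono) (auto simp: G_def indicator_def)
    finally show ?thesis .
  qed
  ultimately show ?thesis by (rule order_trans[rotated])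
qed

text \<open>By independence the joint law of the first \<open>K\<close> variables is the product
  measure, to which \<open>maximal_inequality_PiM\<close> applies. Restricting the sequence to
  \<open>{..<K}\<close> lands in the product space and leaves \<open>F k\<close> unchanged, as it
  reads only coordinates below \<open>k\<close>.\<close>

lemma (in prob_space) maximal_inequality_indep:
  fixes F :: "nat \<Rightarrow> (nat \<Rightarrow> 'b) \<Rightarrow> ennreal"
  assumes indep: "indep_vars (\<lambda>_. N) \<xi> {..<K}" and rv: "\<And>i. random_variable N (\<xi> i)" and "0 < K"
    and law: "\<And>i. \<nu> i = distr M N (\<xi> i)"
    and meas: "\<And>k K. k \<le> K \<Longrightarrow> F k \<in> borel_measurable (PiM {..<K} \<nu>)"
    and local: "\<And>k w w'. (\<And>i. i < k \<Longrightarrow> w i = w' i) \<Longrightarrow> F k w = F k w'"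
    and step: "\<And>k w. w \<in> space (PiM {..<k} \<nu>) \<Longrightarrow> (\<integral>\<^sup>+y. F (Suc k) (w(k := y)) \<partial>\<nu> k) \<le> F k w"
  shows "{\<omega> \<in> space M. \<exists>k\<le>K. c \<le> F k (\<lambda>i. \<xi> i \<omega>)} \<in> events"
    and "c * emeasure M {\<omega> \<in> space M. \<exists>k\<le>K. c \<le> F k (\<lambda>i. \<xi> i \<omega>)} \<le> F 0 (\<lambda>_. undefined)"
proof -
  let ?P = "PiM {..<K} \<nu>" and ?T = "\<lambda>\<omega>. \<lambda>i\<in>{..<K}. \<xi> i \<omega>"
  let ?A = "{w \<in> space ?P. \<exists>k\<le>K. c \<le> F k w}"
  have \<nu>: "prob_space (\<nu> i)" for i
    unfolding law by (rule prob_space_distr[OF rv])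
  have "distr M (PiM {..<K} (\<lambda>_. N)) ?T = (\<Pi>\<^sub>M i\<in>{..<K}. distr M N (\<xi> i))"
    using indep rv \<open>0 < K\<close> by (subst indep_vars_iff_distr_eq_PiM'[symmetric]) auto
  also have "\<dots> = ?P"
    by (rule PiM_cong) (auto simp: law)
  finally have distr: "distr M (PiM {..<K} (\<lambda>_. N)) ?T = ?P" .
  have T: "?T \<in> measurable M (PiM {..<K} (\<lambda>_. N))"
    using rv by (intro measurable_restrict) auto
  have sets_P: "sets ?P = sets (PiM {..<K} (\<lambda>_. N))" by (subst distr[symmetric]) simp
  have "(\<Union>k\<in>{..K}. {w \<in> space ?P. c \<le> F k w}) \<in> sets ?P"
  proof (rule sets.finite_UN)
    fix k assume "k \<in> {..K}"
    then have "F k \<in> borel_measurable ?P" by (intro meas) simp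
    then show "{w \<in> space ?P. c \<le> F k w} \<in> sets ?P" by simp
  qed simp
  moreover have "(\<Union>k\<in>{..K}. {w \<in> space ?P. c \<le> F k w}) = ?A" by blast
  ultimately have A': "?A \<in> sets (PiM {..<K} (\<lambda>_. N))" by (simp only: sets_P)
  have eq: "?T -` ?A \<inter> space M = {\<omega> \<in> space M. \<exists>k\<le>K. c \<le> F k (\<lambda>i. \<xi> i \<omega>)}"
  proof -
    have "F k (?T \<omega>) = F k (\<lambda>i. \<xi> i \<omega>)" if "k \<le> K" for k \<omega>
      using that by (intro local) auto
    moreover have "?T \<omega> \<in> space ?P" if "\<omega> \<in> space M" for \<omega>
      using measurable_space[OF T that] sets_eq_imp_space_eq[OF sets_P] by simp
    ultimately show ?thesis
      by (intro set_eqI) (simp only: vimage_eq Int_iff mem_Collect_eq, metis)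
  qed
  show "{\<omega> \<in> space M. \<exists>k\<le>K. c \<le> F k (\<lambda>i. \<xi> i \<omega>)} \<in> events"
    using measurable_sets[OF T A'] by (simp only: eq)
  have "emeasure M {\<omega> \<in> space M. \<exists>k\<le>K. c \<le> F k (\<lambda>i. \<xi> i \<omega>)} = emeasure ?P ?A"
    using emeasure_distr[OF T A'] by (simp only: eq distr)
  moreover have "c * emeasure ?P ?A \<le> F 0 (\<lambda>_. undefined)"
  proof (rule maximal_inequality_PiM[OF \<nu>])
    show "F k (w(j := y)) = F k w" if "k \<le> j" for k j w y
      using that by (intro local) simp
  qed (fact meas, fact step)
  ultimately show "c * emeasure M {\<omega> \<in> space M. \<exists>k\<le>K. c \<le> F k (\<lambda>i. \<xi> i \<omega>)} \<le> F 0 (\<lambda>_. undefined)"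
    by (simp only:)
qed

section \<open>Mass carried by the killed Euler scheme\<close>

text \<open>The noise only translates, so this Jacobian of one Euler step does not involve the
  increment.\<close>

definition step_jacobian :: "(real^'n \<Rightarrow> real^'n) \<Rightarrow> real \<Rightarrow> real^'n \<Rightarrow> real" where
  "step_jacobian m h y = \<bar>det (mat 1 + h *\<^sub>R matrix (frechet_derivative m (at y)))\<bar>"

text \<open>
  The indicators kill the scheme once it leaves \<open>cball 0 R\<close>, so that the one-step estimate is needed only
  for points of that ball.
\<close>
primrec euler_weight :: "(real^'n \<Rightarrow> real^'n) \<Rightarrow> real \<Rightarrow> real \<Rightarrow> (nat \<Rightarrow> real^'n) \<Rightarrow> nat \<Rightarrow> real^'n \<Rightarrow> real" where
  "euler_weight m h R w 0 x = indicator (cball 0 R) x"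
| "euler_weight m h R w (Suc k) x = euler_weight m h R w k x *
     (step_jacobian m h (euler m h w k x) * indicator (cball 0 R) (euler m h w (Suc k) x))"

text \<open>The integral of \<open>u\<close> over the Euler image, pulled back to the starting
  points and killed. The domain of integration is thus independent of the noise, which allows the
  order of integration to be exchanged.\<close>

definition euler_mass :: "(real^'n \<Rightarrow> real^'n) \<Rightarrow> (real^'n \<Rightarrow> real) \<Rightarrow> real \<Rightarrow> real \<Rightarrow> real \<Rightarrow>
    nat \<Rightarrow> (nat \<Rightarrow> real^'n) \<Rightarrow> ennreal" where
  "euler_mass m u h R r k w =
     (\<integral>\<^sup>+x\<in>cball 0 r. ennreal (euler_weight m h R w k x * u (euler m h w k x)) \<partial>lborel)"

lemma euler_cong: "(\<And>i. i < k \<Longrightarrow> w i = w' i) \<Longrightarrow> euler m h w k x = euler m h w' k x"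
  by (induction k) auto

lemma euler_weight_cong:
  "(\<And>i. i < k \<Longrightarrow> w i = w' i) \<Longrightarrow> euler_weight m h R w k x = euler_weight m h R w' k x"
proof (induction k)
  case (Suc k)
  have "euler m h w k x = euler m h w' k x" "euler m h w (Suc k) x = euler m h w' (Suc k) x"
    using Suc.prems by (intro euler_cong; simp)+
  then show ?case using Suc by simp
qed simp

lemma euler_mass_cong:
  assumes "\<And>i. i < k \<Longrightarrow> w i = w' i"
  shows "euler_mass m u h R r k w = euler_mass m u h R r k w'"
  unfolding euler_mass_def using euler_cong[of k w w'] euler_weight_cong[of k w w'] assms by simp

lemma step_jacobian_nonneg: "0 \<le> step_jacobian m h y"
  by (simp add: step_jacobian_def)

lemma euler_weight_nonneg: "0 \<le> euler_weight m h R w k x"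
  by (induction k) (auto simp: step_jacobian_nonneg)

lemma euler_in_cball_if_weight: "euler_weight m h R w k x \<noteq> 0 \<Longrightarrow> euler m h w k x \<in> cball 0 R"
  by (cases k) (auto simp: indicator_def split: if_splits)

lemma continuous_det_step:
  assumes "C11 m"
  shows "continuous_on UNIV (\<lambda>y. det (mat 1 + h *\<^sub>R matrix (frechet_derivative m (at y))))"
  unfolding det_def
  by (intro continuous_intros C11_continuous_jacobian[OF assms])

lemma measurable_step:
  assumes "C11 m"
  shows "m \<in> borel_measurable borel" "step_jacobian m h \<in> borel_measurable borel"
proof -
  show "m \<in> borel_measurable borel"
    by (rule borel_measurable_continuous_onI[OF C11_continuous[OF assms]])
  show "step_jacobian m h \<in> borel_measurable borel"
    unfolding step_jacobian_def[abs_def]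
    by (intro borel_measurable_continuous_onI continuous_intros continuous_det_step[OF assms])
qed

text \<open>Joint measurability in noise and starting point is what makes the integral over starting
  points measurable in the noise.\<close>

lemma measurable_euler:
  assumes m: "C11 m" and \<nu>: "\<And>i. sets (\<nu> i) = sets borel" and "k \<le> K"
  shows "(\<lambda>(w, x). euler m h w k x) \<in> borel_measurable (PiM {..<K} \<nu> \<Otimes>\<^sub>M borel)"
    and "(\<lambda>(w, x). euler_weight m h R w k x) \<in> borel_measurable (PiM {..<K} \<nu> \<Otimes>\<^sub>M borel)"
proof -
  note [measurable] = measurable_step[OF m]
  have [measurable]: "cball (0::real^'a) R \<in> sets borel" by simp
  let ?P = "PiM {..<K} \<nu> \<Otimes>\<^sub>M (borel :: (real^'a) measure)"
  have E: "(\<lambda>p. euler m h (fst p) k (snd p)) \<in> borel_measurable ?P" if "k \<le> K" for k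
    using that
  proof (induction k)
    case (Suc k)
    have [measurable]: "(\<lambda>p. euler m h (fst p) k (snd p)) \<in> borel_measurable ?P"
      using Suc by simp
    have "(\<lambda>w. w k) \<in> measurable (PiM {..<K} \<nu>) (\<nu> k)"
      using Suc.prems by (intro measurable_component_singleton) auto
    then have [measurable]: "(\<lambda>w. w k) \<in> borel_measurable (PiM {..<K} \<nu>)"
      using measurable_cong_sets[OF refl \<nu>] by blast
    show ?case by simp
  qed simp
  have "(\<lambda>p. euler_weight m h R (fst p) k (snd p)) \<in> borel_measurable ?P" if "k \<le> K" for k
    using that
  proof (induction k)
    case (Suc k)
    have [measurable]: "(\<lambda>p. euler m h (fst p) k (snd p)) \<in> borel_measurable ?P"
      "(\<lambda>p. euler m h (fst p) (Suc k) (snd p)) \<in> borel_measurable ?P"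
      "(\<lambda>p. euler_weight m h R (fst p) k (snd p)) \<in> borel_measurable ?P"
      using Suc E[of k] E[of "Suc k"] by (auto simp del: euler.simps)
    show ?case by (simp del: euler.simps)
  qed simp
  then show "(\<lambda>(w, x). euler m h w k x) \<in> borel_measurable ?P"
    "(\<lambda>(w, x). euler_weight m h R w k x) \<in> borel_measurable ?P"
    using E \<open>k \<le> K\<close> by (simp_all add: case_prod_beta')
qed

lemma measurable_euler_space:
  assumes m: "C11 m"
  shows "(\<lambda>x. euler m h w k x) \<in> borel_measurable borel"
    and "(\<lambda>x. euler_weight m h R w k x) \<in> borel_measurable borel"
proof -
  note [measurable] = measurable_step[OF m]
  have [measurable]: "cball (0::real^'a) R \<in> sets borel" by simp
  show E[measurable]: "(\<lambda>x. euler m h w k x) \<in> borel_measurable borel" for k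
    by (induction k) auto
  show "(\<lambda>x. euler_weight m h R w k x) \<in> borel_measurable borel"
    by (induction k) (auto simp del: euler.simps(2))
qed

lemma measurable_euler_mass:
  assumes m: "C11 m" and \<nu>: "\<And>i. sets (\<nu> i) = sets borel" and k: "k \<le> K" and u: "continuous_on UNIV u"
  shows "euler_mass m u h R r k \<in> borel_measurable (PiM {..<K} \<nu>)"
proof -
  note [measurable] = measurable_euler[OF m \<nu> k] borel_measurable_continuous_onI[OF u]
  have [measurable]: "cball (0::real^'a) r \<in> sets borel" by simp
  show ?thesis
    unfolding euler_mass_def[abs_def] by measurable
qed

text \<open>Fubini moves the integral over the new increment inside the one over starting points.
  There the one-step estimate applies at the current Euler position, which lies in
  \<open>cball 0 R\<close> wherever the weight is nonzero.\<close>

lemma euler_mass_step: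
  fixes u :: "real^'n \<Rightarrow> real"
  assumes m: "C11 m" and u: "continuous_on UNIV u" "\<And>x. 0 \<le> u x" and q: "0 \<le> q"
    and \<nu>: "prob_space \<nu>" "sets \<nu> = sets borel"
    and one_step: "\<And>y. y \<in> cball 0 R \<Longrightarrow> step_jacobian m h y *
      (\<integral>\<xi>. indicator (cball 0 R) (y + h *\<^sub>R m y + \<xi>) * u (y + h *\<^sub>R m y + \<xi>) \<partial>\<nu>) \<le> q * u y"
  shows "(\<integral>\<^sup>+y. euler_mass m u h R r (Suc k) (w(k := y)) \<partial>\<nu>) \<le> ennreal q * euler_mass m u h R r k w"
proof -
  interpret prob_space \<nu> by fact
  interpret P: pair_sigma_finite \<nu> "lborel :: (real^'n) measure" ..
  note [measurable] = measurable_step[OF m] measurable_euler_space[OF m] borel_measurable_continuous_onI[OF u(1)]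
  note [measurable_cong] = \<nu>(2)
  have [measurable]: "cball (0::real^'n) r \<in> sets borel" "cball (0::real^'n) R \<in> sets borel" by simp_all
  let ?E = "\<lambda>x. euler m h w k x" and ?W = "\<lambda>x. euler_weight m h R w k x"
  let ?y = "\<lambda>x. ?E x + h *\<^sub>R m (?E x)"
  let ?F = "\<lambda>x z. indicator (cball 0 R) (?y x + z) * u (?y x + z)"
  obtain B where B: "B > 0" "\<And>x. x \<in> cball 0 R \<Longrightarrow> norm (u x) \<le> B"
    using continuous_bounded_cball[OF u(1)] by metis
  have mass: "euler_mass m u h R r (Suc k) (w(k := z)) =
      (\<integral>\<^sup>+x. ennreal (?W x * step_jacobian m h (?E x)) * ennreal (?F x z) * indicator (cball 0 r) x \<partial>lborel)" for z
  proof -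
    have "euler m h (w(k := z)) k x = ?E x" "euler_weight m h R (w(k := z)) k x = ?W x" for x
      by (auto intro!: euler_cong euler_weight_cong)
    then show ?thesis
      unfolding euler_mass_def
      by (intro nn_integral_cong)
        (simp add: ennreal_mult[symmetric] euler_weight_nonneg step_jacobian_nonneg u(2) mult_ac)
  qed
  have "(\<integral>\<^sup>+z. euler_mass m u h R r (Suc k) (w(k := z)) \<partial>\<nu>) =
      (\<integral>\<^sup>+x. \<integral>\<^sup>+z. ennreal (?W x * step_jacobian m h (?E x)) * ennreal (?F x z) * indicator (cball 0 r) x \<partial>\<nu> \<partial>lborel)"
    unfolding mass by (rule P.Fubini'[symmetric]) measurable
  also have "\<dots> \<le> (\<integral>\<^sup>+x. ennreal q * (ennreal (?W x * u (?E x)) * indicator (cball 0 r) x) \<partial>lborel)"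
  proof (rule nn_integral_mono)
    fix x
    have "?F x \<in> borel_measurable borel" by measurable
    then have [measurable]: "?F x \<in> borel_measurable \<nu>"
      using measurable_cong_sets[OF \<nu>(2) refl] by blast
    moreover have "norm (?F x z) \<le> B" for z
      using B(1) B(2)[of "?y x + z"] by (simp add: indicator_def)
    ultimately have "integrable \<nu> (?F x)"
      by (intro integrable_const_bound[where B = B]) auto
    then have int: "(\<integral>\<^sup>+z. ennreal (?F x z) \<partial>\<nu>) = ennreal (\<integral>z. ?F x z \<partial>\<nu>)"
      using u(2) by (intro nn_integral_eq_integral) auto
    have le: "?W x * step_jacobian m h (?E x) * (\<integral>z. ?F x z \<partial>\<nu>) \<le> q * (?W x * u (?E x))"
    proof (cases "?W x = 0")
      case False
      then have "step_jacobian m h (?E x) * (\<integral>z. ?F x z \<partial>\<nu>) \<le> q * u (?E x)"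
        using one_step[OF euler_in_cball_if_weight] by blast
      from mult_left_mono[OF this euler_weight_nonneg[of m h R w k x]]
      show ?thesis by (simp add: mult_ac)
    qed simp
    have "(\<integral>\<^sup>+z. ennreal (?W x * step_jacobian m h (?E x)) * ennreal (?F x z) * indicator (cball 0 r) x \<partial>\<nu>)
      = ennreal (?W x * step_jacobian m h (?E x)) * (\<integral>\<^sup>+z. ennreal (?F x z) \<partial>\<nu>) * indicator (cball 0 r) x"
      by (subst nn_integral_multc, measurable, subst nn_integral_cmult, measurable)
    also have "\<dots> = ennreal (?W x * step_jacobian m h (?E x) * (\<integral>z. ?F x z \<partial>\<nu>)) * indicator (cball 0 r) x"
      unfolding int by (subst ennreal_mult'[symmetric])
        (auto intro!: mult_nonneg_nonneg euler_weight_nonneg step_jacobian_nonneg Bochner_Integration.integral_nonneg u(2))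
    also have "\<dots> \<le> ennreal (q * (?W x * u (?E x))) * indicator (cball 0 r) x"
      using le by (intro mult_right_mono ennreal_leI) auto
    also have "\<dots> = ennreal q * (ennreal (?W x * u (?E x)) * indicator (cball 0 r) x)"
      by (subst ennreal_mult'[OF q]) (simp only: mult.assoc)
    finally show "(\<integral>\<^sup>+z. ennreal (?W x * step_jacobian m h (?E x)) * ennreal (?F x z) * indicator (cball 0 r) x \<partial>\<nu>)
      \<le> ennreal q * (ennreal (?W x * u (?E x)) * indicator (cball 0 r) x)" .
  qed
  also have "\<dots> = ennreal q * euler_mass m u h R r k w"
    unfolding euler_mass_def by (rule nn_integral_cmult) measurable
  finally show ?thesis .
qed

text \<open>The chain rule and multiplicativity of the determinant turn the Jacobian of the composed
  scheme into the product of the step Jacobians along the orbit.\<close>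

lemma euler_has_derivative:
  assumes m: "C11 m"
  shows "\<exists>g'. \<forall>x. (euler m h w k has_derivative g' x) (at x) \<and>
    det (matrix (g' x)) = (\<Prod>j<k. det (mat 1 + h *\<^sub>R matrix (frechet_derivative m (at (euler m h w j x)))))"
proof (induction k)
  case 0
  show ?case
    by (intro exI[of _ "\<lambda>_ v. v"]) (auto simp: matrix_id_mat_1[unfolded id_def] intro: has_derivative_ident)
next
  case (Suc k)
  then obtain g' where g: "\<And>x. (euler m h w k has_derivative g' x) (at x)"
    and det: "\<And>x. det (matrix (g' x)) = (\<Prod>j<k. det (mat 1 + h *\<^sub>R matrix (frechet_derivative m (at (euler m h w j x)))))"
    by metis
  let ?D = "\<lambda>x. frechet_derivative m (at (euler m h w k x))"
  let ?S = "\<lambda>x v. v + h *\<^sub>R ?D x v"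
  have mder: "(m has_derivative ?D x) (at (euler m h w k x))" for x
    by (rule C11_has_derivative[OF m])
  have lin: "linear (?D x)" "linear (g' x)" for x
    using mder g by (auto intro: has_derivative_linear)
  have linS: "linear (?S x)" for x
    by (intro linear_compose_add linear_compose_scale_right lin linear_ident)
  have "(euler m h w (Suc k) has_derivative ?S x \<circ> g' x) (at x)" for x
  proof -
    have "((\<lambda>y. y + h *\<^sub>R m y + w k) has_derivative ?S x) (at (euler m h w k x))"
      using mder[of x] by (auto intro!: derivative_eq_intros)
    from diff_chain_at[OF g this] show ?thesis
      by (simp add: o_def euler.simps(2)[abs_def])
  qed
  moreover have "det (matrix (?S x \<circ> g' x)) =
      (\<Prod>j<Suc k. det (mat 1 + h *\<^sub>R matrix (frechet_derivative m (at (euler m h w j x)))))" for x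
  proof -
    have "matrix (?S x \<circ> g' x) = matrix (?S x) ** matrix (g' x)"
      by (rule matrix_compose) (use lin linS in \<open>auto simp: linear_matrix_vector_mul_eq\<close>)
    moreover have "matrix (?S x) = mat 1 + h *\<^sub>R matrix (?D x)"
      by (simp add: matrix_def vec_eq_iff mat_def axis_def)
    ultimately show ?thesis
      by (simp add: det_mul det mult.commute)
  qed
  ultimately show ?case by (intro exI[of _ "\<lambda>x. ?S x \<circ> g' x"]) blast
qed

lemma continuous_euler:
  assumes m: "C11 m" shows "continuous_on S (euler m h w k)"
  using euler_has_derivative[OF m, of h w k]
  by (meson continuous_at_imp_continuous_on has_derivative_continuous)

lemma euler_weight_eq_prod:
  "(\<And>j. j \<le> k \<Longrightarrow> euler m h w j x \<in> cball 0 R) \<Longrightarrow>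
    euler_weight m h R w k x = (\<Prod>j<k. step_jacobian m h (euler m h w j x))"
proof (induction k)
  case 0
  from 0[of 0] show ?case by simp
next
  case (Suc k)
  have "euler m h w (Suc k) x \<in> cball 0 R" using Suc.prems by blast
  then show ?case using Suc by (simp del: euler.simps)
qed

text \<open>The orbits never leave \<open>cball 0 R\<close>, so all killing indicators are 1 and the
  weight is the absolute Jacobian in the change of variables.\<close>

lemma euler_image_mass:
  assumes m: "C11 m" and u: "continuous_on UNIV u" "\<And>x. 0 \<le> u x"
    and R: "\<And>x j. x \<in> cball 0 r \<Longrightarrow> j \<le> k \<Longrightarrow> euler m h w j x \<in> cball 0 R"
  shows "(\<integral>\<^sup>+x\<in>euler m h w k ` cball 0 r. ennreal (u x) \<partial>lborel) \<le> euler_mass m u h R r k w"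
proof -
  obtain g' where g: "\<And>x. (euler m h w k has_derivative g' x) (at x)"
    and det: "\<And>x. det (matrix (g' x)) = (\<Prod>j<k. det (mat 1 + h *\<^sub>R matrix (frechet_derivative m (at (euler m h w j x)))))"
    using euler_has_derivative[OF m, of h w k] by metis
  have "(\<integral>\<^sup>+x\<in>euler m h w k ` cball 0 r. ennreal (u x) \<partial>lborel) \<le>
      (\<integral>\<^sup>+x\<in>cball 0 r. ennreal (\<bar>det (matrix (g' x))\<bar> * u (euler m h w k x)) \<partial>lborel)"
    using compact_cball g u
  proof (rule nn_integral_image_le)
    show "continuous_on UNIV (\<lambda>x. det (matrix (g' x)))"
      unfolding det
      by (intro continuous_on_prod continuous_on_compose2[OF continuous_det_step[OF m] continuous_euler[OF m]]) simp
  qed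
  also have "\<dots> = euler_mass m u h R r k w"
    unfolding euler_mass_def
    by (intro nn_integral_cong)
      (auto simp: det abs_prod indicator_def euler_weight_eq_prod[OF R] step_jacobian_def)
  finally show ?thesis .
qed

section \<open>Gaussian increments\<close>

lemma (in prob_space) normal_moments:
  fixes s :: real
  assumes X: "distributed M lborel X (\<lambda>x. ennreal (normal_density 0 s x))" and s: "0 < s"
  shows "has_bochner_integral M X 0" "has_bochner_integral M (\<lambda>\<omega>. (X \<omega>)\<^sup>2) (s\<^sup>2)"
    "has_bochner_integral M (\<lambda>\<omega>. X \<omega> ^ 4) (3 * s ^ 4)"
proof -
  have *: "has_bochner_integral M (\<lambda>\<omega>. g (X \<omega>)) c"
    if g: "g \<in> borel_measurable borel" and i: "has_bochner_integral lborel (\<lambda>x. normal_density 0 s x * g x) c" for g c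
    using distributed_integral[OF X, of g] distributed_integrable[OF X, of g] g i
    by (simp add: has_bochner_integral_iff normal_density_nonneg)
  show "has_bochner_integral M X 0"
    using *[of "\<lambda>x. x" 0] normal_moment_odd[OF s, of 0 0] by simp
  show "has_bochner_integral M (\<lambda>\<omega>. (X \<omega>)\<^sup>2) (s\<^sup>2)"
    using *[of "\<lambda>x. x\<^sup>2" "s\<^sup>2"] normal_moment_even[OF s, of 0 1] by (simp add: fact_numeral)
  show "has_bochner_integral M (\<lambda>\<omega>. X \<omega> ^ 4) (3 * s ^ 4)"
    using *[of "\<lambda>x. x ^ 4" "3 * s ^ 4"] normal_moment_even[OF s, of 0 2] s by (simp add: fact_numeral field_simps)
qed

text \<open>By Cauchy-Schwarz \<open>norm (\<beta> \<omega>) ^ 4\<close> is at most n times the sum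
  of the n fourth powers of the components, each of mean 3 h^2; this gives the factor 3 n^2, next to
  the operator norm of \<sigma> to the fourth power.\<close>

lemma noise_law_matrix_normal:
  fixes \<beta> :: "'w \<Rightarrow> real^'n" and \<sigma> :: "real^'n^'n"
  assumes M: "prob_space M"
    and meas: "\<beta> \<in> borel_measurable M" and h: "0 < h"
    and law: "\<And>j. distributed M lborel (\<lambda>\<omega>. \<beta> \<omega> $ j) (\<lambda>x. ennreal (normal_density 0 (sqrt h) x))"
    and indep: "\<And>j l. j \<noteq> l \<Longrightarrow> has_bochner_integral M (\<lambda>\<omega>. \<beta> \<omega> $ j * \<beta> \<omega> $ l) 0"
  shows "noise_law (\<sigma> ** transpose \<sigma>) (onorm ((*v) \<sigma>) ^ 4 * (3 * (real CARD('n))\<^sup>2)) h (distr M borel (\<lambda>\<omega>. \<sigma> *v \<beta> \<omega>))"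
proof -
  interpret prob_space M by fact
  let ?n = "real CARD('n)" and ?B = "onorm ((*v) \<sigma>)"
  have bl: "bounded_linear ((*v) \<sigma>)" by (rule matrix_vector_mul_bounded_linear)
  have meas_mv: "(*v) \<sigma> \<in> borel_measurable borel"
    by (intro borel_measurable_continuous_onI linear_continuous_on[OF bl])
  have \<xi>: "(\<lambda>\<omega>. \<sigma> *v \<beta> \<omega>) \<in> borel_measurable M"
    using measurable_compose[OF meas meas_mv] .
  note mom = normal_moments[OF law, unfolded real_sqrt_gt_0_iff, OF h]
  have second: "has_bochner_integral M (\<lambda>\<omega>. \<beta> \<omega> $ j * \<beta> \<omega> $ l) (if j = l then h else 0)" for j l
    using mom(2)[of j] indep[of j l] h by (auto simp: power2_eq_square)
  have distr: "has_bochner_integral (distr M borel (\<lambda>\<omega>. \<sigma> *v \<beta> \<omega>)) f c"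
    if "f \<in> borel_measurable borel" "has_bochner_integral M (\<lambda>\<omega>. f (\<sigma> *v \<beta> \<omega>)) c" for f and c :: real
    using that \<xi> by (simp add: has_bochner_integral_iff integrable_distr_eq integral_distr)
  have "has_bochner_integral M (\<lambda>\<omega>. \<Sum>j\<in>UNIV. \<sigma> $ i $ j * \<beta> \<omega> $ j) (\<Sum>j\<in>UNIV. \<sigma> $ i $ j * 0)" for i
    using mom(1) by (intro has_bochner_integral_sum has_bochner_integral_mult_right)
  then have 1: "has_bochner_integral M (\<lambda>\<omega>. (\<sigma> *v \<beta> \<omega>) $ i) 0" for i
    by (simp add: matrix_vector_mult_def)
  have "has_bochner_integral M (\<lambda>\<omega>. \<Sum>j\<in>UNIV. \<Sum>l\<in>UNIV. (\<sigma> $ i $ j * \<sigma> $ k $ l) * (\<beta> \<omega> $ j * \<beta> \<omega> $ l))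
      (\<Sum>j\<in>UNIV. \<Sum>l\<in>UNIV. (\<sigma> $ i $ j * \<sigma> $ k $ l) * (if j = l then h else 0))" for i k
    using second by (intro has_bochner_integral_sum has_bochner_integral_mult_right)
  moreover have "(\<Sum>j\<in>UNIV. \<Sum>l\<in>UNIV. (\<sigma> $ i $ j * \<sigma> $ k $ l) * (\<beta> \<omega> $ j * \<beta> \<omega> $ l)) = (\<sigma> *v \<beta> \<omega>) $ i * (\<sigma> *v \<beta> \<omega>) $ k" for i k \<omega>
    by (simp add: matrix_vector_mult_def sum_product mult_ac)
  moreover have "(\<Sum>j\<in>UNIV. \<Sum>l\<in>UNIV. (\<sigma> $ i $ j * \<sigma> $ k $ l) * (if j = l then h else 0)) = h * (\<sigma> ** transpose \<sigma>) $ i $ k" for i k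
    by (simp add: matrix_matrix_mult_def transpose_def sum_distrib_left mult_ac if_distrib cong: if_cong)
  ultimately have 2: "has_bochner_integral M (\<lambda>\<omega>. (\<sigma> *v \<beta> \<omega>) $ i * (\<sigma> *v \<beta> \<omega>) $ k) (h * (\<sigma> ** transpose \<sigma>) $ i $ k)" for i k
    by simp
  let ?g = "\<lambda>\<omega>. ?B ^ 4 * (?n * (\<Sum>j\<in>UNIV. \<beta> \<omega> $ j ^ 4))"
  have g: "has_bochner_integral M ?g (?B ^ 4 * (?n * (\<Sum>j\<in>(UNIV::'n set). 3 * sqrt h ^ 4)))"
    using mom(3) by (intro has_bochner_integral_sum has_bochner_integral_mult_right)
  have le: "norm (\<sigma> *v \<beta> \<omega>) ^ 4 \<le> ?g \<omega>" for \<omega>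
  proof -
    have "norm (\<sigma> *v \<beta> \<omega>) ^ 4 \<le> (?B * norm (\<beta> \<omega>)) ^ 4"
      by (intro power_mono onorm[OF bl]) auto
    also have "\<dots> = ?B ^ 4 * ((norm (\<beta> \<omega>))\<^sup>2)\<^sup>2"
      by (simp add: power_mult_distrib flip: power_mult)
    also have "(norm (\<beta> \<omega>))\<^sup>2 = (\<Sum>j\<in>UNIV. (\<beta> \<omega> $ j)\<^sup>2)"
      unfolding power2_norm_eq_inner inner_vec_def by (simp add: power2_eq_square)
    also have "(\<Sum>j\<in>UNIV. (\<beta> \<omega> $ j)\<^sup>2)\<^sup>2 \<le> ?n * (\<Sum>j\<in>UNIV. ((\<beta> \<omega> $ j)\<^sup>2)\<^sup>2)"
      using Cauchy_Schwarz_ineq_sum[of "\<lambda>_. 1" "\<lambda>j. (\<beta> \<omega> $ j)\<^sup>2" "UNIV :: 'n set"] by simp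
    finally show ?thesis
      by (simp add: mult_left_mono flip: power_mult)
  qed
  have meas4: "(\<lambda>\<omega>. norm (\<sigma> *v \<beta> \<omega>) ^ 4) \<in> borel_measurable M"
    using \<xi> by simp
  have int4: "integrable M (\<lambda>\<omega>. norm (\<sigma> *v \<beta> \<omega>) ^ 4)"
  proof (rule Bochner_Integration.integrable_bound[OF _ meas4])
    show "integrable M ?g" using g by (simp add: has_bochner_integral_iff)
    show "AE \<omega> in M. norm (norm (\<sigma> *v \<beta> \<omega>) ^ 4) \<le> norm (?g \<omega>)"
      using le by (auto intro: order_trans[OF _ abs_ge_self])
  qed
  have "(\<integral>\<omega>. norm (\<sigma> *v \<beta> \<omega>) ^ 4 \<partial>M) \<le> (\<integral>\<omega>. ?g \<omega> \<partial>M)"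
    using int4 g le by (intro integral_mono) (auto simp: has_bochner_integral_iff)
  also have "\<dots> = ?B ^ 4 * (3 * ?n\<^sup>2) * h\<^sup>2"
  proof -
    have "sqrt h ^ 4 = h\<^sup>2"
      using h power_mult[of "sqrt h" 2 2] by simp
    then show ?thesis
      unfolding has_bochner_integral_integral_eq[OF g] by (simp add: power2_eq_square)
  qed
  finally have 4: "(\<integral>\<omega>. norm (\<sigma> *v \<beta> \<omega>) ^ 4 \<partial>M) \<le> ?B ^ 4 * (3 * ?n\<^sup>2) * h\<^sup>2" .
  have "prob_space (distr M borel (\<lambda>\<omega>. \<sigma> *v \<beta> \<omega>))"
    by (rule prob_space_distr[OF \<xi>])
  moreover have nth: "(\<lambda>x::real^'n. x $ i) \<in> borel_measurable borel" for i
    by (intro borel_measurable_continuous_onI continuous_intros)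
  moreover have "has_bochner_integral (distr M borel (\<lambda>\<omega>. \<sigma> *v \<beta> \<omega>)) (\<lambda>x. x $ i) 0" for i
    by (rule distr[OF nth 1])
  moreover have "has_bochner_integral (distr M borel (\<lambda>\<omega>. \<sigma> *v \<beta> \<omega>)) (\<lambda>x. x $ i * x $ k) (h * (\<sigma> ** transpose \<sigma>) $ i $ k)" for i k
    by (rule distr[OF borel_measurable_times[OF nth nth] 2])
  ultimately show ?thesis
    using int4 4 \<xi> by (auto simp: noise_law_def integrable_distr_eq integral_distr)
qed

text \<open>The Brownian property is sampled at the multiples of \<open>h\<close>. Within one step
  it makes mixed second moments vanish, across steps it makes the vector increments
  independent.\<close>

lemma brownian_increments:
  fixes b :: "real \<Rightarrow> 'w \<Rightarrow> real^'n" and \<sigma> :: "real^'n^'n"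
  assumes BM: "std_brownian_motion M b" and h: "0 < h"
  defines "\<xi> \<equiv> \<lambda>i \<omega>. \<sigma> *v b (real (Suc i) * h) \<omega> - \<sigma> *v b (real i * h) \<omega>"
  shows "\<And>i. \<xi> i \<in> borel_measurable M"
    and "prob_space.indep_vars M (\<lambda>_. borel) \<xi> {..<K}"
    and "\<And>i. noise_law (\<sigma> ** transpose \<sigma>) (onorm ((*v) \<sigma>) ^ 4 * (3 * (real CARD('n))\<^sup>2)) h (distr M borel (\<xi> i))"
proof -
  interpret prob_space M using BM by (simp add: std_brownian_motion_def)
  define t where "t i = real i * h" for i
  define \<beta> where "\<beta> i \<omega> = b (t (Suc i)) \<omega> - b (t i) \<omega>" for i \<omega>
  have \<xi>: "\<xi> = (\<lambda>i \<omega>. \<sigma> *v \<beta> i \<omega>)"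
    by (simp add: \<xi>_def \<beta>_def t_def matrix_vector_mult_diff_distrib fun_eq_iff)
  have [measurable]: "\<And>s. b s \<in> borel_measurable M" using BM by (simp add: std_brownian_motion_def)
  have \<beta>[measurable]: "\<beta> i \<in> borel_measurable M" for i unfolding \<beta>_def[abs_def] by measurable
  have meas_mv: "(*v) \<sigma> \<in> borel_measurable borel"
    by (intro borel_measurable_continuous_onI linear_continuous_on[OF matrix_vector_mul_bounded_linear])
  show "\<xi> i \<in> borel_measurable M" for i
    unfolding \<xi> using measurable_compose[OF \<beta> meas_mv] .
  have t: "0 \<le> t 0" "t i < t (Suc i)" "t (Suc i) - t i = h" for i using h by (auto simp: t_def algebra_simps)
  have BMt: "0 \<le> t 0 \<and> (\<forall>i<k. t i < t (Suc i)) \<longrightarrow>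
        indep_vars (\<lambda>_. borel) (\<lambda>(i, j) \<omega>. b (t (Suc i)) \<omega> $ j - b (t i) \<omega> $ j) ({..<k} \<times> UNIV) \<and>
        (\<forall>i<k. \<forall>j. distributed M lborel (\<lambda>\<omega>. b (t (Suc i)) \<omega> $ j - b (t i) \<omega> $ j)
                       (\<lambda>x. ennreal (normal_density 0 (sqrt (t (Suc i) - t i)) x)))" for k
    using BM unfolding std_brownian_motion_def by blast
  have ind: "indep_vars (\<lambda>_. borel) (\<lambda>(i, j) \<omega>. \<beta> i \<omega> $ j) ({..<k} \<times> UNIV)" for k
    using BMt[of k] t by (simp add: \<beta>_def)
  have law: "distributed M lborel (\<lambda>\<omega>. \<beta> i \<omega> $ j) (\<lambda>x. ennreal (normal_density 0 (sqrt h) x))" for i j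
    using BMt[of "Suc i"] t by (simp add: \<beta>_def)
  show "noise_law (\<sigma> ** transpose \<sigma>) (onorm ((*v) \<sigma>) ^ 4 * (3 * (real CARD('n))\<^sup>2)) h (distr M borel (\<xi> i))" for i
    unfolding \<xi>
  proof (rule noise_law_matrix_normal[OF prob_space_axioms \<beta> h law])
    fix j l :: 'n assume jl: "j \<noteq> l"
    have int: "has_bochner_integral M (\<lambda>\<omega>. \<beta> i \<omega> $ j) 0" for j
      using normal_moments(1)[OF law] h by simp
    have sub: "indep_vars (\<lambda>_. borel) (\<lambda>(i, j) \<omega>. \<beta> i \<omega> $ j) {(i, j), (i, l)}"
      by (rule indep_vars_subset[OF ind[of "Suc i"]]) auto
    have "integrable M (\<lambda>\<omega>. \<Prod>p\<in>{(i, j), (i, l)}. (case p of (i, j) \<Rightarrow> \<lambda>\<omega>. \<beta> i \<omega> $ j) \<omega>)"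
      using int by (intro indep_vars_integrable[OF _ sub]) (auto simp: has_bochner_integral_iff)
    moreover have "(\<integral>\<omega>. (\<Prod>p\<in>{(i, j), (i, l)}. (case p of (i, j) \<Rightarrow> \<lambda>\<omega>. \<beta> i \<omega> $ j) \<omega>) \<partial>M)
        = (\<Prod>p\<in>{(i, j), (i, l)}. \<integral>\<omega>. (case p of (i, j) \<Rightarrow> \<lambda>\<omega>. \<beta> i \<omega> $ j) \<omega> \<partial>M)"
      using int by (intro indep_vars_lebesgue_integral[OF _ sub]) (auto simp: has_bochner_integral_iff)
    ultimately show "has_bochner_integral M (\<lambda>\<omega>. \<beta> i \<omega> $ j * \<beta> i \<omega> $ l) 0"
      using jl int by (simp add: has_bochner_integral_iff)
  qed
  \<comment> \<open>Independence is available for the scalar components indexed by pairs; they are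
    grouped into the blocks \<open>{i} \<times> UNIV\<close>, and this measurable map reassembles
    each block into a vector.\<close>
  have meas_Y: "(\<lambda>f. \<sigma> *v (\<Sum>j\<in>UNIV. f (i, j) *\<^sub>R axis j 1)) \<in> borel_measurable (PiM ({i} \<times> UNIV) (\<lambda>_. borel))" for i :: nat
  proof -
    have "(\<lambda>f. f (i, j) :: real) \<in> borel_measurable (PiM ({i} \<times> UNIV) (\<lambda>_. borel))" for j :: 'n
      by (rule measurable_component_singleton) simp
    then have "(\<lambda>f. \<Sum>j\<in>UNIV. f (i, j) *\<^sub>R (axis j 1 :: real^'n)) \<in> borel_measurable (PiM ({i} \<times> UNIV) (\<lambda>_. borel))"
      by (intro borel_measurable_sum borel_measurable_scaleR borel_measurable_const)
    then show ?thesis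
      using measurable_compose[OF _ meas_mv] by blast
  qed
  have "indep_vars (\<lambda>i. PiM ({i} \<times> UNIV) (\<lambda>_. borel))
      (\<lambda>i \<omega>. restrict (\<lambda>p. (case p of (i, j) \<Rightarrow> \<lambda>\<omega>. \<beta> i \<omega> $ j) \<omega>) ({i} \<times> UNIV)) {..<K}"
    by (rule indep_vars_restrict[OF ind]) (auto simp: disjoint_family_on_def)
  from indep_vars_compose2[OF this meas_Y]
  have "indep_vars (\<lambda>_. borel) (\<lambda>i \<omega>. \<sigma> *v (\<Sum>j\<in>UNIV. restrict (\<lambda>p. (case p of (i, j) \<Rightarrow> \<lambda>\<omega>. \<beta> i \<omega> $ j) \<omega>)
      ({i} \<times> UNIV) (i, j) *\<^sub>R axis j 1)) {..<K}" .
  moreover have "(\<Sum>j\<in>UNIV. \<beta> i \<omega> $ j *\<^sub>R axis j 1) = \<beta> i \<omega>" for i \<omega>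
    using basis_expansion[of "\<beta> i \<omega>"] by (simp add: scalar_mult_eq_scaleR)
  ultimately show "indep_vars (\<lambda>_. borel) \<xi> {..<K}"
    unfolding \<xi> by simp
qed

section \<open>Exponential decay\<close>

text \<open>For small steps the Euler map is uniformly close to the time-\<open>t\<close> map on
  \<open>ball 0 r\<close>, so its image covers that of \<open>A\<close>. The ball is open for the
  covering argument, its closure compact for the change of variables. The thresholds
  \<open>h0\<close> and \<open>R0\<close> depend on the path and on \<open>t\<close>.\<close>

lemma flow_image_le_euler_mass:
  fixes u :: "real^'n \<Rightarrow> real"
  assumes flow: "additive_noise_flow m \<beta> X" and m: "C11 m"
    and u: "continuous_on UNIV u" "\<And>x. 0 \<le> u x"
    and A: "compact A" "A \<subseteq> ball 0 r" and t: "0 \<le> t"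
  obtains h0 R0 where "h0 > 0" "\<And>h R. 0 < h \<Longrightarrow> h \<le> h0 \<Longrightarrow> R0 \<le> R \<Longrightarrow>
    ennreal (integral (X t ` A) u) \<le>
      euler_mass m u h R r (nat \<lfloor>t / h\<rfloor>) (\<lambda>i. \<beta> (real (Suc i) * h) - \<beta> (real i * h))"
proof -
  interpret additive_noise_flow m \<beta> X by fact
  obtain \<eta> where \<eta>: "\<eta> > 0" "\<And>f. continuous_on (ball 0 r) f \<Longrightarrow>
      (\<And>x. x \<in> ball 0 r \<Longrightarrow> norm (f x - X t x) \<le> \<eta>) \<Longrightarrow> X t ` A \<subseteq> f ` ball 0 r"
    by (rule image_subset_image_uniformly_close[OF flow_space_cont[OF t] flow_inj[OF t] open_ball A]) (rule that; blast)
  obtain h0 R0 where conv: "h0 > 0"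
    "\<And>h x s j. 0 < h \<Longrightarrow> h \<le> h0 \<Longrightarrow> x \<in> cball 0 r \<Longrightarrow> s \<in> {0..t} \<Longrightarrow> j \<le> nat \<lfloor>s / h\<rfloor> \<Longrightarrow>
       euler m h (\<lambda>i. \<beta> (real (Suc i) * h) - \<beta> (real i * h)) j x \<in> cball 0 R0"
    "\<And>h x s. 0 < h \<Longrightarrow> h \<le> h0 \<Longrightarrow> x \<in> cball 0 r \<Longrightarrow> s \<in> {0..t} \<Longrightarrow>
       norm (euler m h (\<lambda>i. \<beta> (real (Suc i) * h) - \<beta> (real i * h)) (nat \<lfloor>s / h\<rfloor>) x - X s x) \<le> \<eta>"
    by (rule euler_converges[OF t \<eta>(1), of r]) (rule that; blast)
  have XA: "compact (X t ` A)"
    by (intro compact_continuous_image continuous_on_subset[OF flow_space_cont[OF t]] A) simp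
  have "set_integrable lborel (X t ` A) u"
    unfolding set_integrable_def
    by (intro borel_integrable_compact XA continuous_on_subset[OF u(1)]) simp
  then have "u integrable_on (X t ` A)"
    using set_borel_integral_eq_integral(1) by blast
  then have int: "ennreal (integral (X t ` A) u) = (\<integral>\<^sup>+x\<in>X t ` A. ennreal (u x) \<partial>lborel)"
    using u(2) by (intro nn_integral_has_integral_lebesgue'[symmetric]) (auto simp: has_integral_integral)
  show thesis
  proof (rule that[OF conv(1)])
    fix h R assume h: "0 < h" "h \<le> h0" and R: "R0 \<le> R"
    let ?k = "nat \<lfloor>t / h\<rfloor>" and ?w = "\<lambda>i. \<beta> (real (Suc i) * h) - \<beta> (real i * h)"
    let ?f = "euler m h ?w ?k"
    have "X t ` A \<subseteq> ?f ` ball 0 r"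
    proof (rule \<eta>(2)[OF continuous_euler[OF m]])
      show "norm (?f x - X t x) \<le> \<eta>" if "x \<in> ball 0 r" for x
        using conv(3)[OF h, of x t] that t by simp
    qed
    then have sub: "X t ` A \<subseteq> ?f ` cball 0 r" using ball_subset_cball by blast
    have "(\<integral>\<^sup>+x\<in>X t ` A. ennreal (u x) \<partial>lborel) \<le> (\<integral>\<^sup>+x\<in>?f ` cball 0 r. ennreal (u x) \<partial>lborel)"
      using sub by (intro nn_integral_mono mult_left_mono) (auto simp: indicator_def)
    also have "\<dots> \<le> euler_mass m u h R r ?k ?w"
    proof (rule euler_image_mass[OF m u])
      fix x :: "real^'n" and j assume "x \<in> cball 0 r" "j \<le> ?k"
      then have "euler m h ?w j x \<in> cball 0 R0" using conv(2)[OF h, of x t j] t by simp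
      then show "euler m h ?w j x \<in> cball 0 R" using R by (simp only: mem_cball_0)
    qed
    finally show "ennreal (integral (X t ` A) u) \<le> euler_mass m u h R r ?k ?w"
      unfolding int .
  qed
qed

text \<open>For fixed \<open>c\<close> the tail intersections \<open>L c N\<close> increase with
  \<open>N\<close> and each lies in \<open>E N c\<close>, so their union has probability at most
  \<open>V / real (Suc c)\<close>. A failing path lies in this union for every \<open>c\<close>, and
  letting \<open>c\<close> grow gives probability 0.\<close>

lemma (in prob_space) AE_infinitely_often_not_in:
  fixes E :: "nat \<Rightarrow> nat \<Rightarrow> 'a set"
  assumes E: "\<And>n c. E n c \<in> events" and le: "\<And>n c. real (Suc c) * prob (E n c) \<le> V"
  shows "AE \<omega> in M. \<exists>c. \<forall>N. \<exists>n\<ge>N. \<omega> \<notin> E n c"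
proof -
  define L where "L c N = (\<Inter>n\<in>{N..}. E n c)" for c N
  have L: "L c N \<in> events" for c N
    unfolding L_def using E by (intro sets.countable_INT') auto
  have "prob (\<Inter>c. \<Union>N. L c N) \<le> V / real (Suc c)" for c
  proof -
    have "prob (\<Inter>c. \<Union>N. L c N) \<le> prob (\<Union>N. L c N)"
      using L by (intro finite_measure_mono) auto
    also have "\<dots> \<le> V / real (Suc c)"
    proof (rule LIMSEQ_le_const2)
      show "(\<lambda>N. prob (L c N)) \<longlonglongrightarrow> prob (\<Union>N. L c N)"
        using L by (intro finite_Lim_measure_incseq) (auto simp: incseq_def L_def)
      have "prob (L c N) \<le> V / real (Suc c)" for N
      proof -
        have "prob (L c N) \<le> prob (E N c)" using E by (intro finite_measure_mono) (auto simp: L_def)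
        also have "\<dots> \<le> V / real (Suc c)" using le[of c N] by (simp add: field_simps)
        finally show ?thesis .
      qed
      then show "\<exists>N. \<forall>n\<ge>N. prob (L c n) \<le> V / real (Suc c)" by blast
    qed
    finally show ?thesis .
  qed
  moreover have "(\<lambda>c. V / real (Suc c)) \<longlonglongrightarrow> 0"
    by (rule LIMSEQ_Suc) (rule lim_const_over_n)
  ultimately have "prob (\<Inter>c. \<Union>N. L c N) \<le> 0"
    by (intro LIMSEQ_le_const) auto
  then have "(\<Inter>c. \<Union>N. L c N) \<in> null_sets M"
    using L by (intro null_setsI) (auto simp: emeasure_eq_measure measure_le_0_iff)
  from AE_not_in[OF this] show ?thesis
    by eventually_elim (simp add: L_def, metis atLeast_iff)
qed

text \<open>After taking logarithms and dividing by \<open>t\<close> the prefactor disappears as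
  \<open>ln C / t\<close>. It is raised to at least 1 to make this logarithm meaningful; where
  \<open>f t\<close> is not positive, \<open>eln\<close> is minus infinity.\<close>

lemma Limsup_eln_le:
  assumes "\<And>t. 0 \<le> t \<Longrightarrow> f t \<le> c * exp (d * t)"
  shows "Limsup at_top (\<lambda>t. eln (f t) / ereal t) \<le> ereal d"
proof -
  define C where "C = max c 1"
  have C: "C > 0" "c \<le> C" by (auto simp: C_def)
  have "eln (f t) / ereal t \<le> ereal (ln C / t + d)" if t: "0 < t" for t
  proof (cases "f t \<le> 0")
    case True
    then show ?thesis using t by (simp add: eln_def)
  next
    case False
    have "f t \<le> c * exp (d * t)" using assms t by simp
    also have "\<dots> \<le> C * exp (d * t)" using C by (intro mult_right_mono) auto
    finally have "ln (f t) \<le> ln (C * exp (d * t))" using False C by (subst ln_le_cancel_iff) auto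
    also have "\<dots> = ln C + d * t" using C by (simp add: ln_mult)
    finally have "ln (f t) / t \<le> ln C / t + d" using t by (simp add: field_simps)
    then show ?thesis using False t by (simp add: eln_def)
  qed
  then have "Limsup at_top (\<lambda>t. eln (f t) / ereal t) \<le> Limsup at_top (\<lambda>t. ereal (ln C / t + d))"
    by (intro Limsup_mono eventually_mono[OF eventually_gt_at_top[of 0]]) auto
  also have "\<dots> = ereal d"
  proof (rule lim_imp_Limsup)
    have "((\<lambda>t. ln C / t + d) \<longlongrightarrow> 0 + d) at_top"
      by (intro tendsto_intros tendsto_divide_0[OF tendsto_const] filterlim_at_top_imp_at_infinity filterlim_ident)
    then show "((\<lambda>t. ereal (ln C / t + d)) \<longlongrightarrow> ereal d) at_top" by simp
  qed simp
  finally show ?thesis .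
qed

text \<open>The constant may depend on the path but must serve all times at once, whereas the Euler
  approximation is good only after a threshold depending on \<open>t\<close>. The maximal
  inequality, uniform over all grid times of scheme \<open>n\<close> and with a bound independent of
  \<open>n\<close>, reconciles the two.\<close>

lemma mass_decay_AE:
  fixes M :: "'w measure" and b :: "real \<Rightarrow> 'w \<Rightarrow> real^'n" and \<sigma> :: "real^'n^'n" and u :: "real^'n \<Rightarrow> real"
  assumes BM: "std_brownian_motion M b" and m: "C11 m"
    and flow: "\<And>\<omega>. \<omega> \<in> space M \<Longrightarrow> additive_noise_flow m (\<lambda>t. \<sigma> *v b t \<omega>) (\<lambda>t x. X t x \<omega>)"
    and u: "C2 u" "\<And>x. u x > 0" and super: "\<And>x. Lsharp (\<sigma> ** transpose \<sigma>) m u x \<le> - \<mu> * u x"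
    and A: "compact A" and e: "0 < e" "e < \<mu>"
  shows "AE \<omega> in M. \<exists>c. \<forall>t\<ge>0. integral ((\<lambda>x. X t x \<omega>) ` A) u \<le> c * exp ((e - \<mu>) * t)"
proof -
  interpret prob_space M using BM by (simp add: std_brownian_motion_def)
  have contu: "continuous_on UNIV u" by (rule C2_continuous[OF u(1)])
  have u0: "0 \<le> u x" for x using u(2)[of x] by simp
  obtain r where r: "A \<subseteq> ball 0 r"
    using compact_imp_bounded[OF A] bounded_subset_ballD by metis
  define \<kappa> where "\<kappa> = onorm ((*v) \<sigma>) ^ 4 * (3 * (real CARD('n))\<^sup>2)"
  have \<kappa>: "0 \<le> \<kappa>"
    by (simp add: \<kappa>_def onorm_pos_le[OF matrix_vector_mul_bounded_linear])
  let ?J = "\<lambda>h \<nu> R y. step_jacobian m h y *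
      (\<integral>\<xi>. indicator (cball 0 R) (y + h *\<^sub>R m y + \<xi>) * u (y + h *\<^sub>R m y + \<xi>) \<partial>\<nu>)"
  define good where "good R h0 \<longleftrightarrow> h0 > 0 \<and> (\<forall>h \<nu> y. 0 < h \<longrightarrow> h \<le> h0 \<longrightarrow> noise_law (\<sigma> ** transpose \<sigma>) \<kappa> h \<nu> \<longrightarrow>
      y \<in> cball 0 R \<longrightarrow> ?J h \<nu> R y \<le> (1 + (e - \<mu>) * h) * u y)" for R h0
  have "\<exists>h0. good R h0" for R
    by (rule one_step_supermartingale[OF m u e(1) \<kappa> super, of R])
      (auto simp: good_def step_jacobian_def intro!: exI)
  then obtain h0 where good: "\<And>R. good R (h0 R)"
    by metis
  have h0: "h0 R > 0" for R
    using good[of R] by (simp add: good_def)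
  have one: "?J h \<nu> R y \<le> (1 + (e - \<mu>) * h) * u y"
    if "0 < h" "h \<le> h0 R" "noise_law (\<sigma> ** transpose \<sigma>) \<kappa> h \<nu>" "y \<in> cball 0 R" for R h \<nu> y
    using good[of R] that unfolding good_def by blast
  \<comment> \<open>The three bounds are for the one-step estimate on the ball of radius
    \<open>n\<close>, for convergence to 0 with steps at most 1, and for positivity of the factor
    \<open>q n\<close>.\<close>
  define H where "H n = min (h0 (real n)) (min (1 / (real n + 1)) (1 / (2 * \<mu>)))" for n :: nat
  have \<mu>: "\<mu> > 0" using e by simp
  have H: "H n > 0" "H n \<le> h0 (real n)" "H n \<le> 1 / (real n + 1)" "H n \<le> 1 / (2 * \<mu>)" for n
    using h0 \<mu> by (auto simp: H_def)
  define q where "q n = 1 + (e - \<mu>) * H n" for n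
  have q: "q n > 0" "q n \<le> exp ((e - \<mu>) * H n)" for n
  proof -
    have "(\<mu> - e) * H n \<le> \<mu> * (1 / (2 * \<mu>))" using e \<mu> H[of n] by (intro mult_mono) (auto simp: less_imp_le)
    also have "\<dots> < 1" using \<mu> by simp
    finally show "q n > 0" by (simp add: q_def algebra_simps)
    show "q n \<le> exp ((e - \<mu>) * H n)" unfolding q_def by (rule exp_ge_add_one_self)
  qed
  define \<xi> where "\<xi> n i \<omega> = \<sigma> *v b (real (Suc i) * H n) \<omega> - \<sigma> *v b (real i * H n) \<omega>" for n i \<omega>
  note incr = brownian_increments[OF BM H(1), where \<sigma> = \<sigma>, folded \<xi>_def \<kappa>_def]
  define \<nu> where "\<nu> n i = distr M borel (\<xi> n i)" for n i
  have \<nu>: "prob_space (\<nu> n i)" "sets (\<nu> n i) = sets borel" "noise_law (\<sigma> ** transpose \<sigma>) \<kappa> (H n) (\<nu> n i)" for n i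
    using incr(3) unfolding \<nu>_def by (auto simp: noise_law_def)
  \<comment> \<open>Dividing by \<open>q n ^ k\<close> compensates the one-step factor; the result
    is a supermartingale with initial value at most \<open>V\<close>.\<close>
  define F where "F n k w = ennreal (inverse (q n) ^ k) * euler_mass m u (H n) (real n) r k w" for n k w
  have F_meas: "F n k \<in> borel_measurable (PiM {..<K} (\<nu> n))" if "k \<le> K" for n k K
    unfolding F_def[abs_def] by (intro borel_measurable_times_ennreal borel_measurable_const measurable_euler_mass m \<nu> that contu)
  have F_step: "(\<integral>\<^sup>+y. F n (Suc k) (w(k := y)) \<partial>\<nu> n k) \<le> F n k w" if w: "w \<in> space (PiM {..<k} (\<nu> n))" for n k w
  proof -
    have "(\<lambda>y. w(k := y)) \<in> measurable (\<nu> n k) (PiM {..<Suc k} (\<nu> n))"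
      using measurable_component_update[OF w, of k] by (simp add: lessThan_Suc)
    from measurable_compose[OF this measurable_euler_mass[OF m \<nu>(2) order_refl contu]]
    have "(\<integral>\<^sup>+y. F n (Suc k) (w(k := y)) \<partial>\<nu> n k)
      = ennreal (inverse (q n) ^ Suc k) * (\<integral>\<^sup>+y. euler_mass m u (H n) (real n) r (Suc k) (w(k := y)) \<partial>\<nu> n k)"
      unfolding F_def by (rule nn_integral_cmult)
    also have "\<dots> \<le> ennreal (inverse (q n) ^ Suc k) * (ennreal (q n) * euler_mass m u (H n) (real n) r k w)"
    proof (rule mult_left_mono, rule euler_mass_step[OF m contu u0 _ \<nu>(1,2)])
      show "?J (H n) (\<nu> n k) (real n) y \<le> q n * u y" if "y \<in> cball 0 (real n)" for y
        unfolding q_def using one[OF H(1,2) \<nu>(3) that] .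
    qed (use q in \<open>auto simp: less_imp_le\<close>)
    also have "\<dots> = ennreal (inverse (q n) ^ Suc k * q n) * euler_mass m u (H n) (real n) r k w"
      using q(1)[of n] by (subst ennreal_mult) (auto simp: mult.assoc less_imp_le)
    also have "inverse (q n) ^ Suc k * q n = inverse (q n) ^ k"
      using q(1)[of n] by (simp add: field_simps)
    finally show ?thesis by (simp only: F_def)
  qed
  have F_cong: "F n k w = F n k w'" if "\<And>i. i < k \<Longrightarrow> w i = w' i" for n k w w'
    unfolding F_def by (subst euler_mass_cong[OF that]) auto
  define V where "V = integral (cball 0 r) u"
  have "u integrable_on cball 0 r"
    using set_borel_integral_eq_integral(1)[of "cball 0 r" u]
      borel_integrable_compact[OF compact_cball[of 0 r] continuous_on_subset[OF contu]]
    by (auto simp: set_integrable_def)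
  then have V: "(\<integral>\<^sup>+x\<in>cball 0 r. ennreal (u x) \<partial>lborel) = ennreal V"
    unfolding V_def using u0 by (intro nn_integral_has_integral_lebesgue') (auto simp: has_integral_integral)
  have V0: "0 \<le> V" unfolding V_def using u0 by (intro Henstock_Kurzweil_Integration.integral_nonneg \<open>u integrable_on _\<close>)
  have F0: "F n 0 w \<le> ennreal V" for n w
  proof -
    have "F n 0 w \<le> (\<integral>\<^sup>+x\<in>cball 0 r. ennreal (u x) \<partial>lborel)"
      unfolding F_def euler_mass_def using u0
      by (auto intro!: nn_integral_mono simp: indicator_def)
    then show ?thesis by (simp add: V)
  qed
  \<comment> \<open>Enough steps to reach time \<open>n\<close>; the added 1 keeps the index set
    nonempty for \<open>n = 0\<close>, as \<open>maximal_inequality_indep\<close> demands.\<close>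
  define K where "K n = nat \<lceil>real n / H n\<rceil> + 1" for n
  have "0 < K n" for n by (simp add: K_def)
  define E where "E n c = {\<omega> \<in> space M. \<exists>k\<le>K n. ennreal (real (Suc c)) \<le> F n k (\<lambda>i. \<xi> n i \<omega>)}" for n c
  note max = maximal_inequality_indep[OF incr(2) incr(1) \<open>0 < K _\<close> \<nu>_def F_meas F_cong F_step]
  have E_sets: "E n c \<in> events" for n c
    unfolding E_def by (rule max(1))
  have E_prob: "real (Suc c) * prob (E n c) \<le> V" for n c
  proof -
    have "ennreal (real (Suc c)) * emeasure M (E n c) \<le> ennreal V"
      unfolding E_def by (rule order_trans[OF max(2) F0])
    then show ?thesis
      using V0 by (simp add: emeasure_eq_measure ennreal_mult[symmetric] del: of_nat_Suc)
  qed
  show ?thesis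
    using AE_infinitely_often_not_in[where E = E and V = V, OF E_sets E_prob] AE_space[of M]
  proof eventually_elim
    case (elim \<omega>)
    then obtain c where c: "\<And>N. \<exists>n\<ge>N. \<omega> \<notin> E n c" and \<omega>: "\<omega> \<in> space M" by blast
    \<comment> \<open>\<open>exp (\<mu> - e)\<close> pays for rounding \<open>t\<close> down to the
      grid, which costs at most time 1. The index \<open>c\<close> has been fixed before
      \<open>t\<close>.\<close>
    show ?case
    proof (intro exI[of _ "real (Suc c) * exp (\<mu> - e)"] allI impI)
      fix t :: real assume t: "0 \<le> t"
      let ?I = "integral ((\<lambda>x. X t x \<omega>) ` A) u"
      obtain h1 R1 where h1: "h1 > 0" "\<And>h R. 0 < h \<Longrightarrow> h \<le> h1 \<Longrightarrow> R1 \<le> R \<Longrightarrow>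
          ennreal ?I \<le> euler_mass m u h R r (nat \<lfloor>t / h\<rfloor>)
            (\<lambda>i. \<sigma> *v b (real (Suc i) * h) \<omega> - \<sigma> *v b (real i * h) \<omega>)"
        by (rule flow_image_le_euler_mass[OF flow[OF \<omega>] m contu u0 A r t]) (rule that; blast)
      \<comment> \<open>The three summands bring the step below \<open>h1\<close>, the radius above
        \<open>R1\<close> and the horizon above \<open>t\<close>; infinitely many good indices
        guarantee one beyond them.\<close>
      obtain n where n: "n \<ge> nat \<lceil>1 / h1\<rceil> + nat \<lceil>R1\<rceil> + nat \<lceil>t\<rceil>" "\<omega> \<notin> E n c"
        using c by blast
      have "1 / h1 \<le> real n" "R1 \<le> real n" "t \<le> real n" using n(1) by linarith+
      have "H n \<le> h1"
      proof -
        have "H n \<le> 1 / (real n + 1)" by (rule H(3))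
        also have "\<dots> \<le> h1" using \<open>1 / h1 \<le> real n\<close> h1(1) by (simp add: field_simps add_pos_nonneg)
        finally show ?thesis .
      qed
      define k where "k = nat \<lfloor>t / H n\<rfloor>"
      have le: "ennreal ?I \<le> euler_mass m u (H n) (real n) r k (\<lambda>i. \<xi> n i \<omega>)"
        unfolding k_def \<xi>_def by (rule h1(2)[OF H(1) \<open>H n \<le> h1\<close> \<open>R1 \<le> real n\<close>])
      have "k \<le> K n"
      proof -
        have "t / H n \<le> real n / H n" using \<open>t \<le> real n\<close> H(1)[of n] by (intro divide_right_mono) auto
        then have "\<lfloor>t / H n\<rfloor> \<le> \<lceil>real n / H n\<rceil>" by linarith
        then show ?thesis by (simp add: k_def K_def nat_mono le_SucI)
      qed
      then have "\<not> ennreal (real (Suc c)) \<le> F n k (\<lambda>i. \<xi> n i \<omega>)"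
        using n(2) \<omega> unfolding E_def by blast
      moreover have "ennreal (inverse (q n) ^ k * ?I) \<le> F n k (\<lambda>i. \<xi> n i \<omega>)"
        unfolding F_def using le q(1)[of n] by (subst ennreal_mult') (auto intro!: mult_left_mono simp: less_imp_le)
      ultimately have "ennreal (inverse (q n) ^ k * ?I) \<le> ennreal (real (Suc c))" by (meson le_cases order_trans)
      then have "inverse (q n) ^ k * ?I \<le> real (Suc c)"
        by (subst (asm) ennreal_le_iff) auto
      then have "?I \<le> real (Suc c) * q n ^ k"
        using q(1)[of n] by (simp add: field_simps)
      also have "q n ^ k \<le> exp ((e - \<mu>) * H n) ^ k"
        using q[of n] by (intro power_mono) auto
      also have "\<dots> = exp ((e - \<mu>) * (real k * H n))"
        by (subst exp_of_nat_mult[symmetric]) (simp add: mult_ac)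
      also have "\<dots> \<le> exp ((e - \<mu>) * (t - 1))"
      proof -
        have "t / H n < real k + 1" using t H(1)[of n] by (simp add: k_def of_nat_nat)
        then have "t < real k * H n + H n" using H(1)[of n] by (simp add: field_simps)
        moreover have "1 / (real n + 1) \<le> 1" by simp
        then have "H n \<le> 1" using H(3)[of n] by linarith
        ultimately have "t - 1 \<le> real k * H n" by linarith
        then show ?thesis using e by (simp add: mult_left_mono_neg)
      qed
      also have "\<dots> = exp (\<mu> - e) * exp ((e - \<mu>) * t)"
        by (simp add: exp_add[symmetric] algebra_simps)
      finally show "?I \<le> real (Suc c) * exp (\<mu> - e) * exp ((e - \<mu>) * t)"
        by (simp add: mult_left_mono)
    qed
  qed
qed

theorem theorem5p2:
  fixes M :: "'w measure"
    and b :: "real \<Rightarrow> 'w \<Rightarrow> real^'n"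
    and \<sigma> :: "real^'n^'n"
    and m :: "real^'n \<Rightarrow> real^'n"
    and \<psi> :: "real^'n \<Rightarrow> real"
    and lam_c :: real
    and X :: "real \<Rightarrow> real^'n \<Rightarrow> 'w \<Rightarrow> real^'n"
    and u :: "real^'n \<Rightarrow> real"
    and A :: "(real^'n) set"
  assumes dim: "CARD('n) \<ge> 2"
    and BM: "std_brownian_motion M b"
    and sigma_sym: "transpose \<sigma> = \<sigma>"
    and sigma_pd: "\<forall>v. v \<noteq> 0 \<longrightarrow> v \<bullet> (\<sigma> *v v) > 0"
    and m_C11: "C11 m"
    and psi_pos: "\<forall>x. \<psi> x > 0"
    and psi_diff: "\<forall>x. \<psi> differentiable (at x)"
    and m_psi: "\<forall>x. m x = - ((\<sigma> ** transpose \<sigma>) *v grad (\<lambda>y. ln (\<psi> y)) x)"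
    and psi_int: "((\<lambda>x. 1 / (\<psi> x)\<^sup>2) has_integral 1) UNIV"
    and lam_pos: "lam_c > 0"
    and div_m: "\<forall>x. divg m x \<le> - lam_c"
    and flow: "\<forall>\<omega>\<in>space M. \<forall>x. continuous_on {0..} (\<lambda>s. X s x \<omega>) \<and>
                 (\<forall>t\<ge>0. X t x \<omega> = x + \<sigma> *v b t \<omega> + integral {0..t} (\<lambda>s. m (X s x \<omega>)))"
    and u_C2: "C2 u"
    and u_pos: "\<forall>x. u x > 0"
    and u_super: "\<forall>x. Lsharp (\<sigma> ** transpose \<sigma>) m u x \<le> - (lam_c / 2) * u x"
    and A_compact: "compact A"
  shows "AE \<omega> in M. Limsup at_top (\<lambda>t. eln (integral ((\<lambda>x. X t x \<omega>) ` A) u) / ereal t)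
                      \<le> ereal (- lam_c / 2)"
proof -
  let ?\<mu> = "lam_c / 2"
  have noise_flow: "additive_noise_flow m (\<lambda>t. \<sigma> *v b t \<omega>) (\<lambda>t x. X t x \<omega>)" if \<omega>: "\<omega> \<in> space M" for \<omega>
  proof
    show "continuous_on {0..} (\<lambda>t. \<sigma> *v b t \<omega>)"
      using BM \<omega>
      by (intro continuous_on_compose2[OF linear_continuous_on[OF matrix_vector_mul_bounded_linear[of \<sigma>], of UNIV]])
        (auto simp: std_brownian_motion_def)
    show "\<sigma> *v b 0 \<omega> = 0"
      using BM \<omega> by (simp add: std_brownian_motion_def)
    show "continuous_on UNIV m" by (rule C11_continuous[OF m_C11])
  qed (use flow \<omega> in \<open>auto intro: C11_lipschitz_cball[OF m_C11]\<close>)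
  \<comment> \<open>The loss must lie strictly between 0 and the rate, hence \<open>j + 2\<close>.
    Countably many losses tending to 0 permit a common null set.\<close>
  have "AE \<omega> in M. \<exists>c. \<forall>t\<ge>0. integral ((\<lambda>x. X t x \<omega>) ` A) u \<le> c * exp ((?\<mu> / (real j + 2) - ?\<mu>) * t)" for j :: nat
  proof (rule mass_decay_AE[OF BM m_C11 noise_flow u_C2 _ _ A_compact])
    show "0 < ?\<mu> / (real j + 2)"
      using lam_pos by (intro divide_pos_pos) auto
    show "?\<mu> / (real j + 2) < ?\<mu>"
      using lam_pos mult_strict_left_mono[of 1 "real j + 2" ?\<mu>] by (subst pos_divide_less_eq) auto
  qed (use u_pos u_super in auto)
  then have "AE \<omega> in M. \<forall>j::nat. \<exists>c. \<forall>t\<ge>0. integral ((\<lambda>x. X t x \<omega>) ` A) u \<le> c * exp ((?\<mu> / (real j + 2) - ?\<mu>) * t)"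
    by (simp add: AE_all_countable)
  then show ?thesis
  proof eventually_elim
    case (elim \<omega>)
    let ?L = "Limsup at_top (\<lambda>t. eln (integral ((\<lambda>x. X t x \<omega>) ` A) u) / ereal t)"
    have le: "?L \<le> ereal (?\<mu> / (real j + 2) - ?\<mu>)" for j :: nat
    proof -
      obtain c where "\<forall>t\<ge>0. integral ((\<lambda>x. X t x \<omega>) ` A) u \<le> c * exp ((?\<mu> / (real j + 2) - ?\<mu>) * t)"
        using elim by blast
      then show ?thesis by (intro Limsup_eln_le) auto
    qed
    have lim: "(\<lambda>j. ereal (?\<mu> / (real j + 2) - ?\<mu>)) \<longlonglongrightarrow> ereal (- ?\<mu>)"
    proof -
      have "(\<lambda>j. ?\<mu> / (real j + 2) - ?\<mu>) \<longlonglongrightarrow> 0 - ?\<mu>"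
        using LIMSEQ_ignore_initial_segment[OF lim_const_over_n[of ?\<mu>], of 2]
        by (intro tendsto_diff tendsto_const) (simp add: add.commute)
      then show ?thesis by simp
    qed
    have "?L \<le> ereal (- ?\<mu>)"
      by (rule LIMSEQ_le_const[OF lim]) (use le in blast)
    then show "?L \<le> ereal (- lam_c / 2)" by simp
  qed
qed

end
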